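(* Let $a,b\in\mathbb{R}$ with $a<b$, and let $\partial\colon H^1([a,b];\mathbb{R})\subseteq L_2([a,b];\mathbb{R})\to L_2([a,b];\mathbb{R})$, $f\mapsto f'$, be the weak derivative. Let $B\subseteq\partial$ be a (not necessarily linear) restriction of $\partial$. Then $B$ is $m$-accretive if and only if there exists a function $g\colon\mathbb{R}\to\mathbb{R}$ with $$|g(c)-g(d)|\le \mathrm{e}^{a+b}|c-d|\quad\text{for all }c,d\in\mathbb{R}$$ such that $$\operatorname{dom}(B)=\left\{u\in H^1([a,b];\mathbb{R})\,;\,\frac{u(a)\mathrm{e}^{-a}-u(b)\mathrm{e}^{-b}}{\mathrm{e}^{-2a}-\mathrm{e}^{-2b}}=g\left(\frac{u(b)\mathrm{e}^{b}-u(a)\mathrm{e}^{a}}{\mathrm{e}^{2b}-\mathrm{e}^{2a}}\right)\right\}.$$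
   Context: $H^1([a,b];\mathbb{R})=\{f\in L_2([a,b];\mathbb{R})\,;\,f'\in L_2([a,b];\mathbb{R})\}$ with $f'$ the distributional derivative; point values $u(a),u(b)$ are those of the continuous representative. $B\subseteq\partial$ means that $B$ is the restriction of $\partial$ to some subset $\operatorname{dom}(B)\subseteq H^1([a,b];\mathbb{R})$, not necessarily a subspace. Such $B$ is accretive if $\langle B(u)-B(v),u-v\rangle_{L_2}\ge0$ for all $u,v\in\operatorname{dom}(B)$, and $m$-accretive if moreover for each $f\in L_2([a,b];\mathbb{R})$ there is $u\in\operatorname{dom}(B)$ with $u+B(u)=f$. *)

theory Defs
  imports "HOL-Analysis.Analysis"
begin

definition square_integrable :: "real \<Rightarrow> real \<Rightarrow> (real \<Rightarrow> real) set" where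
  "square_integrable a b =
     {f. f \<in> borel_measurable (lebesgue_on {a..b}) \<and> integrable (lebesgue_on {a..b}) (\<lambda>x. (f x)\<^sup>2)}"

text \<open>Functions are total on the reals, but only their values on \<open>{a..b}\<close> matter for membership
  in a class.\<close>

definition l2_class :: "real \<Rightarrow> real \<Rightarrow> (real \<Rightarrow> real) \<Rightarrow> (real \<Rightarrow> real) set" where
  "l2_class a b f = {h \<in> square_integrable a b. AE x in lebesgue_on {a..b}. h x = f x}"

definition L2 :: "real \<Rightarrow> real \<Rightarrow> (real \<Rightarrow> real) set set" where
  "L2 a b = l2_class a b ` square_integrable a b"

text \<open>Operations on classes are computed on a chosen representative; the lemmas below show that
  the choice is immaterial.\<close>

definition l2_rep :: "(real \<Rightarrow> real) set \<Rightarrow> real \<Rightarrow> real" where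
  "l2_rep U = (SOME f. f \<in> U)"

definition l2_add ::
    "real \<Rightarrow> real \<Rightarrow> (real \<Rightarrow> real) set \<Rightarrow> (real \<Rightarrow> real) set \<Rightarrow> (real \<Rightarrow> real) set" where
  "l2_add a b U V = l2_class a b (\<lambda>x. l2_rep U x + l2_rep V x)"

definition l2_diff ::
    "real \<Rightarrow> real \<Rightarrow> (real \<Rightarrow> real) set \<Rightarrow> (real \<Rightarrow> real) set \<Rightarrow> (real \<Rightarrow> real) set" where
  "l2_diff a b U V = l2_class a b (\<lambda>x. l2_rep U x - l2_rep V x)"

definition l2_inner :: "real \<Rightarrow> real \<Rightarrow> (real \<Rightarrow> real) set \<Rightarrow> (real \<Rightarrow> real) set \<Rightarrow> real" where
  "l2_inner a b U V = (\<integral>x. l2_rep U x * l2_rep V x \<partial>lebesgue_on {a..b})"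

lemma l2_class_self: "f \<in> square_integrable a b \<Longrightarrow> f \<in> l2_class a b f"
  by (simp add: l2_class_def)

lemma l2_class_cong:
  assumes "AE x in lebesgue_on {a..b}. f x = g x"
  shows "l2_class a b f = l2_class a b g"
  unfolding l2_class_def using assms by (auto elim: AE_mp)

lemma l2_rep_class:
  assumes "f \<in> square_integrable a b"
  shows "l2_rep (l2_class a b f) \<in> square_integrable a b"
    and "AE x in lebesgue_on {a..b}. l2_rep (l2_class a b f) x = f x"
proof -
  have "l2_rep (l2_class a b f) \<in> l2_class a b f"
    unfolding l2_rep_def by (rule someI[of "\<lambda>h. h \<in> l2_class a b f"], rule l2_class_self, fact)
  then show "l2_rep (l2_class a b f) \<in> square_integrable a b"
    and "AE x in lebesgue_on {a..b}. l2_rep (l2_class a b f) x = f x"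
    by (auto simp: l2_class_def)
qed

lemma l2_add_class:
  assumes "f \<in> square_integrable a b" "g \<in> square_integrable a b"
  shows "l2_add a b (l2_class a b f) (l2_class a b g) = l2_class a b (\<lambda>x. f x + g x)"
  unfolding l2_add_def
  by (rule l2_class_cong) (use l2_rep_class(2)[OF assms(1)] l2_rep_class(2)[OF assms(2)] in auto)

lemma l2_diff_class:
  assumes "f \<in> square_integrable a b" "g \<in> square_integrable a b"
  shows "l2_diff a b (l2_class a b f) (l2_class a b g) = l2_class a b (\<lambda>x. f x - g x)"
  unfolding l2_diff_def
  by (rule l2_class_cong) (use l2_rep_class(2)[OF assms(1)] l2_rep_class(2)[OF assms(2)] in auto)

lemma l2_inner_class:
  assumes "f \<in> square_integrable a b" "g \<in> square_integrable a b"
  shows "l2_inner a b (l2_class a b f) (l2_class a b g) = (\<integral>x. f x * g x \<partial>lebesgue_on {a..b})"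
  unfolding l2_inner_def
proof (rule integral_cong_AE)
  show "AE x in lebesgue_on {a..b}.
      l2_rep (l2_class a b f) x * l2_rep (l2_class a b g) x = f x * g x"
    using l2_rep_class(2)[OF assms(1)] l2_rep_class(2)[OF assms(2)] by auto
qed (use l2_rep_class(1)[OF assms(1)] l2_rep_class(1)[OF assms(2)] assms
     in \<open>auto simp: square_integrable_def intro!: borel_measurable_times\<close>)

text \<open>Smooth functions with compact support in the open interval; the support is closed and
  bounded by definition, hence compact.\<close>

definition test_fun :: "real \<Rightarrow> real \<Rightarrow> (real \<Rightarrow> real) \<Rightarrow> bool" where
  "test_fun a b \<phi> \<longleftrightarrow>
     (\<forall>n x. (deriv ^^ n) \<phi> differentiable (at x)) \<and> closure {x. \<phi> x \<noteq> 0} \<subseteq> {a<..<b}"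

definition is_weak_deriv ::
    "real \<Rightarrow> real \<Rightarrow> (real \<Rightarrow> real) set \<Rightarrow> (real \<Rightarrow> real) set \<Rightarrow> bool" where
  "is_weak_deriv a b U V \<longleftrightarrow>
     (\<forall>\<phi>. test_fun a b \<phi> \<longrightarrow>
        (\<integral>x. l2_rep U x * deriv \<phi> x \<partial>lebesgue_on {a..b})
          = - (\<integral>x. l2_rep V x * \<phi> x \<partial>lebesgue_on {a..b}))"

definition H1 :: "real \<Rightarrow> real \<Rightarrow> (real \<Rightarrow> real) set set" where
  "H1 a b = {U \<in> L2 a b. \<exists>V \<in> L2 a b. is_weak_deriv a b U V}"

text \<open>Operators in the space of square-integrable functions are identified with their graphs, so
  that a restriction of an operator is a subset of its graph.\<close>

type_synonym l2_operator = "((real \<Rightarrow> real) set \<times> (real \<Rightarrow> real) set) set"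

definition weak_deriv_op :: "real \<Rightarrow> real \<Rightarrow> l2_operator" where
  "weak_deriv_op a b = {(U, V). U \<in> H1 a b \<and> V \<in> L2 a b \<and> is_weak_deriv a b U V}"

definition cont_rep :: "real \<Rightarrow> real \<Rightarrow> (real \<Rightarrow> real) set \<Rightarrow> real \<Rightarrow> real" where
  "cont_rep a b U = (SOME f. f \<in> U \<and> continuous_on {a..b} f)"

text \<open>The values of the continuous representative on \<open>{a..b}\<close> do not depend on the choice.\<close>

lemma cont_rep_eq:
  assumes "a < b" "U \<in> L2 a b" "f \<in> U" "continuous_on {a..b} f" "x \<in> {a..b}"
  shows "cont_rep a b U x = f x"
proof -
  define h where "h = cont_rep a b U"
  have h: "h \<in> U \<and> continuous_on {a..b} h"
    unfolding h_def cont_rep_def by (rule someI[of _ f]) (use assms in auto)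
  have "AE x in lebesgue_on {a..b}. h x = f x"
    using h assms(2,3) by (auto simp: L2_def l2_class_def)
  then have ae: "AE x in lebesgue. x \<in> {a..b} \<longrightarrow> h x = f x"
    by (subst (asm) AE_restrict_space_iff) auto
  have cont: "continuous_on {a..b} (\<lambda>x. h x - f x)"
    using h assms(4) by (auto intro: continuous_on_diff)
  have closed: "closed {x \<in> {a..b}. h x - f x = 0}"
    by (rule continuous_closed_preimage_constant[OF cont]) auto
  have "AE x\<in>{a<..<b} in lebesgue. x \<in> {x \<in> {a..b}. h x - f x = 0}"
    using ae by eventually_elim auto
  then have "h y - f y = 0" if "y \<in> {a<..<b}" for y
    using mem_closed_if_AE_lebesgue_open[OF open_greaterThanLessThan closed _ that] by simp
  moreover have "continuous_on (closure {a<..<b}) (\<lambda>x. h x - f x)"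
    using cont assms(1) by simp
  ultimately have "h x - f x = 0"
    using continuous_constant_on_closure[of "{a<..<b}" "\<lambda>x. h x - f x" 0 x] assms(1,5) by auto
  then show ?thesis by (simp add: h_def)
qed

definition accretive :: "real \<Rightarrow> real \<Rightarrow> l2_operator \<Rightarrow> bool" where
  "accretive a b B \<longleftrightarrow>
     (\<forall>(U, X) \<in> B. \<forall>(V, Y) \<in> B. 0 \<le> l2_inner a b (l2_diff a b X Y) (l2_diff a b U V))"

definition m_accretive :: "real \<Rightarrow> real \<Rightarrow> l2_operator \<Rightarrow> bool" where
  "m_accretive a b B \<longleftrightarrow>
     accretive a b B \<and> (\<forall>F \<in> L2 a b. \<exists>(U, X) \<in> B. l2_add a b U X = F)"

end

theory Submission
  imports Defs
begin

text \<open>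
  The two quotients in the theorem are coordinates of the boundary values of \<open>u\<close>: if \<open>p\<close> denotes the first and
  \<open>q\<close> the second one, then \<open>q * exp x + p * exp (- x)\<close> takes the value \<open>u a\<close> at \<open>a\<close> and \<open>u b\<close> at \<open>b\<close>. In these
  coordinates the two parts of \<open>m\<close>-accretivity separate.

  Accretivity only concerns the boundary values, since \<open>\<langle>u' - v', u - v\<rangle>\<close> is half the difference of
  \<open>(u b - v b)\<^sup>2\<close> and \<open>(u a - v a)\<^sup>2\<close>. In the coordinates, this is a positive multiple of
  \<open>(exp (a + b) * \<Delta>q)\<^sup>2 - (\<Delta>p)\<^sup>2\<close>. So \<open>B\<close> is accretive if and only if \<open>p\<close> is, on the domain of \<open>B\<close>, a function of \<open>q\<close> with
  Lipschitz constant \<open>exp (a + b)\<close> (\<open>weak_deriv_op_pair_monotone_iff\<close>).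

  The equation \<open>u + u' = f\<close> says that \<open>(exp * u)' = exp * f\<close>. Its right-hand side \<open>f\<close> determines \<open>q\<close> through the
  integral of \<open>exp * f\<close> (\<open>resolvent_determines_growing_boundary\<close>), while \<open>p\<close> is free and singles out one solution
  (\<open>exists_resolvent_solution_with_boundary\<close>, \<open>resolvent_injective_if_decaying_boundary_eq\<close>). All real numbers
  occur as \<open>q\<close>. So solvability for all \<open>f\<close> says that the function \<open>p = g q\<close> is defined on all of the real line and that the
  domain contains every \<open>u\<close> whose coordinates lie on its graph.

  All of this needs that a weakly differentiable \<open>u\<close> has an absolutely continuous representative whose
  derivative is the weak one (\<open>weak_deriv_op_iff\<close>). This is the lemma of du Bois-Reymond, which rests on a supply of
  test functions built from \<open>exp (- 1 / x)\<close>; the product rule for absolutely continuous functions is Fubini's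
  theorem (\<open>ac_with_deriv_integration_by_parts\<close>).
\<close>

section \<open>Absolutely continuous functions on an interval\<close>

text \<open>Absolute continuity of \<open>f\<close> on \<open>{a..b}\<close> with derivative \<open>v\<close> almost everywhere, encoded by the
  fundamental theorem of calculus: this is the form in which derivatives are used below.\<close>

definition ac_with_deriv :: "real \<Rightarrow> real \<Rightarrow> (real \<Rightarrow> real) \<Rightarrow> (real \<Rightarrow> real) \<Rightarrow> bool" where
  "ac_with_deriv a b f v \<longleftrightarrow>
     integrable (lebesgue_on {a..b}) v \<and>
     (\<forall>x\<in>{a..b}. f x = f a + integral\<^sup>L (lebesgue_on {a..x}) v)"

lemma ac_with_derivD:
  assumes "ac_with_deriv a b f v"
  shows "integrable (lebesgue_on {a..b}) v"
    and "x \<in> {a..b} \<Longrightarrow> f x = f a + integral\<^sup>L (lebesgue_on {a..x}) v"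
  using assms unfolding ac_with_deriv_def by blast+

lemma integrable_lebesgue_on_subinterval:
  fixes v :: "real \<Rightarrow> real"
  assumes "integrable (lebesgue_on {a..b}) v" "x \<in> {a..b}"
  shows "integrable (lebesgue_on {a..x}) v"
  by (rule Equivalence_Lebesgue_Henstock_Integration.integrable_subinterval[OF assms(1)])
     (use assms(2) in auto)

lemma integral_lebesgue_on_singleton:
  fixes v :: "real \<Rightarrow> real"
  shows "integral\<^sup>L (lebesgue_on {a}) v = 0"
  using has_bochner_integral_null[of "{a}" v]
  by (simp add: has_bochner_integral_iff flip: negligible_iff_null_sets)

lemma ac_with_deriv_continuous_on:
  assumes "ac_with_deriv a b f v"
  shows "continuous_on {a..b} f"
proof -
  have "continuous_on {a..b} (\<lambda>x. f a + integral\<^sup>L (lebesgue_on {a..x}) v)"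
    by (intro continuous_intros indefinite_integral_continuous_real ac_with_derivD(1)[OF assms])
  then show ?thesis
    by (rule continuous_on_eq) (rule ac_with_derivD(2)[OF assms, symmetric])
qed

lemma ac_with_deriv_subinterval:
  assumes "ac_with_deriv a b f v" "x \<in> {a..b}"
  shows "ac_with_deriv a x f v"
  unfolding ac_with_deriv_def
proof (intro conjI ballI)
  show "integrable (lebesgue_on {a..x}) v"
    by (rule integrable_lebesgue_on_subinterval[OF ac_with_derivD(1)[OF assms(1)] assms(2)])
  show "f y = f a + integral\<^sup>L (lebesgue_on {a..y}) v" if "y \<in> {a..x}" for y
    by (rule ac_with_derivD(2)[OF assms(1)]) (use that assms(2) in auto)
qed

lemma integrable_continuous_mult:
  fixes f v :: "real \<Rightarrow> real"
  assumes f: "continuous_on {a..b} f" and v: "integrable (lebesgue_on {a..b}) v"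
  shows "integrable (lebesgue_on {a..b}) (\<lambda>x. f x * v x)"
proof -
  have "bounded (f ` {a..b})"
    by (rule compact_imp_bounded[OF compact_continuous_image[OF f]]) auto
  then obtain C where C: "\<And>x. x \<in> {a..b} \<Longrightarrow> \<bar>f x\<bar> \<le> C"
    unfolding bounded_iff by (metis imageI real_norm_def)
  have [measurable]: "f \<in> borel_measurable (lebesgue_on {a..b})"
    by (rule continuous_imp_measurable_on_sets_lebesgue[OF f]) auto
  have [measurable]: "v \<in> borel_measurable (lebesgue_on {a..b})"
    using v by simp
  show ?thesis
  proof (rule Bochner_Integration.integrable_bound)
    show "integrable (lebesgue_on {a..b}) (\<lambda>x. C * \<bar>v x\<bar>)"
      using v by auto
    show "AE x in lebesgue_on {a..b}. norm (f x * v x) \<le> norm (C * \<bar>v x\<bar>)"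
    proof (rule AE_I2)
      fix x assume "x \<in> space (lebesgue_on {a..b})"
      then have "\<bar>f x\<bar> \<le> C" using C by simp
      then show "norm (f x * v x) \<le> norm (C * \<bar>v x\<bar>)"
        by (simp add: abs_mult mult_right_mono)
    qed
  qed measurable
qed

lemma integral_lebesgue_on_subinterval:
  fixes w :: "real \<Rightarrow> real"
  assumes "x \<in> {a..b}"
  shows "integral\<^sup>L (lebesgue_on {a..x}) w
    = (\<integral>y. (if y \<le> x then w y else 0) \<partial>lebesgue_on {a..b})"
proof -
  have "integral\<^sup>L (lebesgue_on {a..x}) w = (\<integral>y. indicator {a..x} y *\<^sub>R w y \<partial>lebesgue)"
    by (rule integral_restrict_space) auto
  also have "\<dots> = (\<integral>y. indicator {a..b} y *\<^sub>R (if y \<le> x then w y else 0) \<partial>lebesgue)"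
    by (rule Bochner_Integration.integral_cong) (use assms in \<open>auto simp: indicator_def\<close>)
  also have "\<dots> = (\<integral>y. (if y \<le> x then w y else 0) \<partial>lebesgue_on {a..b})"
    by (rule integral_restrict_space[symmetric]) auto
  finally show ?thesis .
qed

text \<open>After subtracting the initial values, \<open>f\<close> and \<open>h\<close> become \<open>F x = \<integral> v\<close> and \<open>W x = \<integral> w\<close> over
  \<open>{a..x}\<close>. Then \<open>F b * W b\<close> is the integral of \<open>v x * w y\<close> over the square, and the two triangles cut off
  by the diagonal contribute the integrals of \<open>W * v\<close> and \<open>F * w\<close> by Fubini's theorem.\<close>

lemma ac_with_deriv_integration_by_parts:
  assumes ab: "a \<le> b" and f: "ac_with_deriv a b f v" and h: "ac_with_deriv a b h w"
  shows "(\<integral>x. f x * w x + h x * v x \<partial>lebesgue_on {a..b}) = f b * h b - f a * h a"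
proof -
  define M where "M = lebesgue_on {a..b}"
  define F where "F x = f x - f a" for x
  define W where "W x = h x - h a" for x
  have v: "integrable M v" and w: "integrable M w"
    using ac_with_derivD(1)[OF f] ac_with_derivD(1)[OF h] by (simp_all add: M_def)
  have [measurable]: "v \<in> borel_measurable M" "w \<in> borel_measurable M"
    using v w by simp_all
  have [measurable]: "(\<lambda>x. x) \<in> borel_measurable M"
    using id_borel_measurable_lebesgue_on by (simp add: M_def id_def)
  interpret M: finite_measure M
    unfolding M_def by (rule finite_measure_lebesgue_on) auto
  interpret pair_sigma_finite M M ..
  have intf: "integrable M (\<lambda>x. f x * w x)" and inth: "integrable M (\<lambda>x. h x * v x)"
    using ac_with_deriv_continuous_on[OF f] ac_with_deriv_continuous_on[OF h] v w
    by (auto simp: M_def intro!: integrable_continuous_mult)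
  have F_eq: "F x = (\<integral>y. (if y \<le> x then v y else 0) \<partial>M)" if "x \<in> {a..b}" for x
    using ac_with_derivD(2)[OF f that] integral_lebesgue_on_subinterval[OF that, of v]
    by (simp add: F_def M_def)
  have W_eq: "W x = (\<integral>y. (if y \<le> x then w y else 0) \<partial>M)" if "x \<in> {a..b}" for x
    using ac_with_derivD(2)[OF h that] integral_lebesgue_on_subinterval[OF that, of w]
    by (simp add: W_def M_def)
  have Fb: "F b = integral\<^sup>L M v" and Wb: "W b = integral\<^sup>L M w"
    using ab ac_with_derivD(2)[OF f, of b] ac_with_derivD(2)[OF h, of b]
    by (auto simp: F_def W_def M_def)
  \<comment> \<open>The integrand \<open>v x * w y\<close> on the triangles below and above the diagonal.\<close>
  define T1 where "T1 = (\<lambda>(x, y). if y \<le> x then v x * w y else 0)"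
  define T2 where "T2 = (\<lambda>x y. if x \<le> y then v x * w y else 0)"
  have prod: "integrable (M \<Otimes>\<^sub>M M) (\<lambda>(x, y). v x * w y)"
  proof (rule Fubini_integrable)
    show "integrable M (\<lambda>x. \<integral> y. norm (case (x, y) of (x, y) \<Rightarrow> v x * w y) \<partial>M)"
      using v by (simp add: abs_mult)
    show "AE x in M. integrable M (\<lambda>y. case (x, y) of (x, y) \<Rightarrow> v x * w y)"
      using w by simp
  qed measurable
  have T1: "integrable (M \<Otimes>\<^sub>M M) T1"
    by (rule Bochner_Integration.integrable_bound[OF prod]) (auto simp: T1_def)
  have T2: "integrable (M \<Otimes>\<^sub>M M) (case_prod T2)"
    by (rule Bochner_Integration.integrable_bound[OF prod]) (auto simp: T2_def)
  have "(\<integral>x. W x * v x \<partial>M) = (\<integral>x. (\<integral>y. T1 (x, y) \<partial>M) \<partial>M)"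
  proof (rule Bochner_Integration.integral_cong[OF refl])
    fix x assume "x \<in> space M"
    then have "W x * v x = (\<integral>y. v x * (if y \<le> x then w y else 0) \<partial>M)"
      using W_eq[of x] by (simp add: M_def)
    also have "\<dots> = (\<integral>y. T1 (x, y) \<partial>M)"
      by (rule Bochner_Integration.integral_cong) (auto simp: T1_def)
    finally show "W x * v x = (\<integral>y. T1 (x, y) \<partial>M)" .
  qed
  moreover have "(\<integral>y. F y * w y \<partial>M) = (\<integral>y. (\<integral>x. T2 x y \<partial>M) \<partial>M)"
  proof (rule Bochner_Integration.integral_cong[OF refl])
    fix y assume "y \<in> space M"
    then have "F y * w y = (\<integral>x. (if x \<le> y then v x else 0) * w y \<partial>M)"
      using F_eq[of y] by (simp add: M_def)
    also have "\<dots> = (\<integral>x. T2 x y \<partial>M)"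
      by (rule Bochner_Integration.integral_cong) (auto simp: T2_def)
    finally show "F y * w y = (\<integral>x. T2 x y \<partial>M)" .
  qed
  moreover have "(\<integral>y. (\<integral>x. T2 x y \<partial>M) \<partial>M) = (\<integral>x. (\<integral>y. T2 x y \<partial>M) \<partial>M)"
    by (rule Fubini_integral[OF T2])
  moreover have "(\<integral>x. (\<integral>y. T1 (x, y) \<partial>M) \<partial>M) + (\<integral>x. (\<integral>y. T2 x y \<partial>M) \<partial>M)
      = (\<integral>x. v x * integral\<^sup>L M w \<partial>M)"
  proof -
    have i1: "integrable M (\<lambda>x. \<integral>y. T1 (x, y) \<partial>M)"
      by (rule integrable_fst'[OF T1])
    have i2: "integrable M (\<lambda>x. \<integral>y. T2 x y \<partial>M)"
      using integrable_fst'[OF T2] by simp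
    have "(\<integral>x. (\<integral>y. T1 (x, y) \<partial>M) \<partial>M) + (\<integral>x. (\<integral>y. T2 x y \<partial>M) \<partial>M)
      = (\<integral>x. (\<integral>y. T1 (x, y) \<partial>M) + (\<integral>y. T2 x y \<partial>M) \<partial>M)"
      using i1 i2 by simp
    also have "\<dots> = (\<integral>x. v x * integral\<^sup>L M w \<partial>M)"
    proof (rule Bochner_Integration.integral_cong[OF refl])
      fix x assume x: "x \<in> space M"
      have vw: "integrable M (\<lambda>y. v x * w y)"
        using w by simp
      have 1: "integrable M (\<lambda>y. T1 (x, y))"
        by (rule Bochner_Integration.integrable_bound[OF vw]) (simp_all add: T1_def)
      have 2: "integrable M (T2 x)"
        unfolding T2_def by (rule Bochner_Integration.integrable_bound[OF vw]) simp_all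
      have "(\<integral>y. T1 (x, y) \<partial>M) + (\<integral>y. T2 x y \<partial>M) = (\<integral>y. T1 (x, y) + T2 x y \<partial>M)"
        using 1 2 by simp
      also have "\<dots> = (\<integral>y. v x * w y \<partial>M)"
      proof (rule integral_cong_AE)
        have "{x} \<in> null_sets M"
          using x by (auto simp: M_def null_sets_restrict_space)
        then have "AE y in M. y \<notin> {x}"
          by (rule AE_not_in)
        then show "AE y in M. T1 (x, y) + T2 x y = v x * w y"
          by eventually_elim (auto simp: T1_def T2_def)
      qed (use 1 2 in auto)
      finally show "(\<integral>y. T1 (x, y) \<partial>M) + (\<integral>y. T2 x y \<partial>M) = v x * integral\<^sup>L M w"
        by simp
    qed
    finally show ?thesis .
  qed
  ultimately have key: "(\<integral>x. W x * v x \<partial>M) + (\<integral>y. F y * w y \<partial>M) = F b * W b"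
    by (simp add: Fb Wb)
  have "(\<integral>x. W x * v x \<partial>M) = (\<integral>x. h x * v x \<partial>M) - h a * F b"
    using inth v by (simp add: W_def Fb left_diff_distrib)
  moreover have "(\<integral>x. F x * w x \<partial>M) = (\<integral>x. f x * w x \<partial>M) - f a * W b"
    using intf w by (simp add: F_def Wb left_diff_distrib)
  ultimately have "(\<integral>x. f x * w x \<partial>M) + (\<integral>x. h x * v x \<partial>M) = F b * W b + h a * F b + f a * W b"
    using key by simp
  also have "\<dots> = f b * h b - f a * h a"
    by (simp add: F_def W_def algebra_simps)
  finally show ?thesis
    using intf inth by (simp add: M_def)
qed

text \<open>Integration by parts on every initial interval \<open>{a..x}\<close> is the product rule.\<close>

lemma ac_with_deriv_mult:
  assumes f: "ac_with_deriv a b f v" and h: "ac_with_deriv a b h w"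
  shows "ac_with_deriv a b (\<lambda>x. f x * h x) (\<lambda>x. f x * w x + h x * v x)"
  unfolding ac_with_deriv_def
proof (intro conjI ballI)
  show "integrable (lebesgue_on {a..b}) (\<lambda>x. f x * w x + h x * v x)"
    by (intro Bochner_Integration.integrable_add integrable_continuous_mult
        ac_with_deriv_continuous_on[OF f] ac_with_deriv_continuous_on[OF h]
        ac_with_derivD(1)[OF f] ac_with_derivD(1)[OF h])
  fix x assume x: "x \<in> {a..b}"
  then show "f x * h x = f a * h a + (\<integral>x. f x * w x + h x * v x \<partial>lebesgue_on {a..x})"
    using ac_with_deriv_integration_by_parts[of a x f v h w]
      ac_with_deriv_subinterval[OF f x] ac_with_deriv_subinterval[OF h x] by simp
qed

lemma ac_with_deriv_diff:
  assumes f: "ac_with_deriv a b f v" and h: "ac_with_deriv a b h w"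
  shows "ac_with_deriv a b (\<lambda>x. f x - h x) (\<lambda>x. v x - w x)"
  unfolding ac_with_deriv_def
proof (intro conjI ballI)
  show "integrable (lebesgue_on {a..b}) (\<lambda>x. v x - w x)"
    using ac_with_derivD(1)[OF f] ac_with_derivD(1)[OF h] by simp
  fix x assume x: "x \<in> {a..b}"
  show "f x - h x = f a - h a + (\<integral>x. v x - w x \<partial>lebesgue_on {a..x})"
    using ac_with_derivD(2)[OF f x] ac_with_derivD(2)[OF h x]
      integrable_lebesgue_on_subinterval[OF ac_with_derivD(1)[OF f] x]
      integrable_lebesgue_on_subinterval[OF ac_with_derivD(1)[OF h] x] by simp
qed

lemma ac_with_deriv_C1:
  assumes "\<And>x. (f has_real_derivative f' x) (at x)" "continuous_on {a..b} f'"
  shows "ac_with_deriv a b f f'"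
  unfolding ac_with_deriv_def
proof (intro conjI ballI)
  show int: "integrable (lebesgue_on {a..b}) f'"
    using assms(2) by (rule continuous_imp_integrable_real)
  fix x assume x: "x \<in> {a..b}"
  have "(f' has_integral (f x - f a)) {a..x}"
    by (rule fundamental_theorem_of_calculus)
       (use x assms(1) in \<open>auto simp: has_real_derivative_iff_has_vector_derivative
          intro: has_vector_derivative_at_within\<close>)
  then show "f x = f a + integral\<^sup>L (lebesgue_on {a..x}) f'"
    using lebesgue_integral_eq_integral[OF integrable_lebesgue_on_subinterval[OF int x]]
    by (simp add: integral_unique)
qed

lemma AE_lebesgue_on_subinterval:
  assumes "AE t in lebesgue_on {a..b}. P t" "x \<in> {a..b}"
  shows "AE t in lebesgue_on {a..x::real}. P t"
proof -
  have "AE t in lebesgue. t \<in> {a..b} \<longrightarrow> P t"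
    using assms(1) by (subst (asm) AE_restrict_space_iff) auto
  then have "AE t in lebesgue. t \<in> {a..x} \<longrightarrow> P t"
    by eventually_elim (use assms(2) in auto)
  then show ?thesis
    by (subst AE_restrict_space_iff) auto
qed

lemma ac_with_deriv_cong_AE:
  assumes "ac_with_deriv a b f v" "AE x in lebesgue_on {a..b}. v x = w x"
    "integrable (lebesgue_on {a..b}) w"
  shows "ac_with_deriv a b f w"
  unfolding ac_with_deriv_def
proof (intro conjI ballI)
  fix x assume x: "x \<in> {a..b}"
  have "integral\<^sup>L (lebesgue_on {a..x}) v = integral\<^sup>L (lebesgue_on {a..x}) w"
    by (rule integral_cong_AE)
       (use AE_lebesgue_on_subinterval[OF assms(2) x]
          integrable_lebesgue_on_subinterval[OF ac_with_derivD(1)[OF assms(1)] x]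
          integrable_lebesgue_on_subinterval[OF assms(3) x] in auto)
  then show "f x = f a + integral\<^sup>L (lebesgue_on {a..x}) w"
    using ac_with_derivD(2)[OF assms(1) x] by simp
qed (rule assms(3))

text \<open>By Lebesgue's differentiation theorem, \<open>w x\<close> is for almost every \<open>x\<close> the limit of the averages of
  \<open>w\<close> over \<open>{x..x + h}\<close>, and these vanish.\<close>

lemma AE_eq_0_if_interval_integrals_eq_0:
  fixes w :: "real \<Rightarrow> real"
  assumes w: "integrable (lebesgue_on {a..b}) w"
    and zero: "\<And>c d. a < c \<Longrightarrow> c < d \<Longrightarrow> d < b \<Longrightarrow> integral\<^sup>L (lebesgue_on {c..d}) w = 0"
  shows "AE x in lebesgue_on {a..b}. w x = 0"
proof -
  define g where "g x = indicator {a..b} x *\<^sub>R w x" for x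
  have "integrable lebesgue g"
    using w unfolding g_def by (subst (asm) integrable_restrict_space) auto
  then have g: "g integrable_on cbox c d" for c d
    by (meson integrable_on_lebesgue integrable_on_subcbox subset_UNIV)
  obtain N where N: "negligible N"
    "\<And>x e. x \<notin> N \<Longrightarrow> 0 < e \<Longrightarrow> \<exists>d>0. \<forall>h. 0 < h \<and> h < d \<longrightarrow>
        norm (integral (cbox x (x + h *\<^sub>R One)) g /\<^sub>R h ^ DIM(real) - g x) < e"
    using integrable_ccontinuous_explicit[of g, OF g] by metis
  have "w x = 0" if x: "x \<notin> N" "a < x" "x < b" for x
  proof (rule ccontr)
    assume "w x \<noteq> 0"
    then obtain d where d: "d > 0" "\<And>h. 0 < h \<Longrightarrow> h < d \<Longrightarrow>
        norm (integral (cbox x (x + h *\<^sub>R One)) g /\<^sub>R h ^ DIM(real) - g x) < \<bar>w x\<bar>"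
      using N(2)[of x "\<bar>w x\<bar>"] x by auto
    \<comment> \<open>Small enough for the estimate and for \<open>{x..x + h}\<close> to stay inside the interval.\<close>
    define h where "h = min d (b - x) / 2"
    have h: "0 < h" "h < d" "x + h < b"
      using d(1) x by (auto simp: h_def min_def field_simps)
    have "integral {x..x + h} g = integral {x..x + h} w"
      by (rule Henstock_Kurzweil_Integration.integral_cong) (use x h in \<open>auto simp: g_def\<close>)
    also have "\<dots> = integral\<^sup>L (lebesgue_on {x..x + h}) w"
      by (rule lebesgue_integral_eq_integral[symmetric],
          rule Equivalence_Lebesgue_Henstock_Integration.integrable_subinterval[OF w])
         (use x h in auto)
    also have "\<dots> = 0"
      using x h by (intro zero) auto
    finally have "integral (cbox x (x + h *\<^sub>R One)) g = 0"
      by (simp add: cbox_interval)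
    then show False
      using d(2)[OF h(1,2)] x by (simp add: g_def)
  qed
  moreover have "AE x in lebesgue. x \<notin> N \<union> {a, b}"
    using N(1) by (intro AE_not_in) (simp add: negligible_iff_null_sets[symmetric] negligible_Un_eq)
  ultimately have "AE x in lebesgue. x \<in> {a..b} \<longrightarrow> w x = 0"
    by (elim eventually_mono) (metis Un_iff atLeastAtMost_iff insert_iff less_eq_real_def)
  then show ?thesis
    by (subst AE_restrict_space_iff) auto
qed

section \<open>Test functions and the lemma of du Bois-Reymond\<close>

text \<open>The function \<open>exp (- 1 / x)\<close>, continued by \<open>0\<close> to the left of the origin, together with all products of it
  with polynomials in \<open>1 / x\<close>: these are needed because all its derivatives have this form.\<close>

definition flat :: "real poly \<Rightarrow> real \<Rightarrow> real" where
  "flat p x = (if x > 0 then poly p (1 / x) * exp (- (1 / x)) else 0)"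

lemma poly_div_exp_tendsto_0: "((\<lambda>t. poly p t / exp t) \<longlongrightarrow> (0::real)) at_top"
proof -
  have "((\<lambda>t. \<Sum>i\<le>degree p. coeff p i * (t ^ i / exp t)) \<longlongrightarrow> (\<Sum>i\<le>degree p. coeff p i * 0)) at_top"
    by (intro tendsto_intros tendsto_power_div_exp_0)
  then show ?thesis
    by (simp add: poly_altdef sum_divide_distrib)
qed

lemma flat_tendsto_0: "((\<lambda>x. poly p (1 / x) * exp (- (1 / x))) \<longlongrightarrow> 0) (at_right (0::real))"
proof -
  have "((\<lambda>x. poly p (inverse x) / exp (inverse x)) \<longlongrightarrow> 0) (at_right (0::real))"
    by (rule filterlim_compose[OF poly_div_exp_tendsto_0 filterlim_inverse_at_top_right])
  then show ?thesis
    by (simp add: exp_minus inverse_eq_divide)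
qed

text \<open>The factor \<open>x\<^sup>2\<close> in the new polynomial comes from the derivative of \<open>1 / x\<close>. At the origin, the difference
  quotient is itself of the form \<open>p (1 / h) * exp (- 1 / h)\<close> and tends to \<open>0\<close> because the exponential beats
  every polynomial in \<open>1 / h\<close>.\<close>

lemma DERIV_flat:
  "(flat p has_real_derivative flat ([:0, 0, 1:] * (p - pderiv p)) x) (at x)"
proof -
  consider "x > 0" | "x < 0" | "x = 0" by linarith
  then show ?thesis
  proof cases
    case 1
    have "((\<lambda>x. poly p (1 / x) * exp (- (1 / x))) has_real_derivative
        flat ([:0, 0, 1:] * (p - pderiv p)) x) (at x)"
      using 1 by (auto intro!: derivative_eq_intros simp: flat_def power2_eq_square algebra_simps)
    then show ?thesis
      by (rule has_field_derivative_transform_within_open[where S = "{0<..}"])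
         (use 1 in \<open>auto simp: flat_def\<close>)
  next
    case 2
    have "((\<lambda>x. 0) has_real_derivative flat ([:0, 0, 1:] * (p - pderiv p)) x) (at x)"
      using 2 by (simp add: flat_def)
    then show ?thesis
      by (rule has_field_derivative_transform_within_open[where S = "{..<0}"])
         (use 2 in \<open>auto simp: flat_def\<close>)
  next
    case 3
    \<comment> \<open>Division by \<open>h\<close> multiplies the polynomial in \<open>1 / h\<close> by its variable.\<close>
    have "((\<lambda>h. flat p h / h) \<longlongrightarrow> 0) (at_right 0)"
    proof (rule Lim_transform_eventually[OF flat_tendsto_0[of "pCons 0 p"]])
      show "\<forall>\<^sub>F h in at_right 0. poly (pCons 0 p) (1 / h) * exp (- (1 / h)) = flat p h / h"
        using eventually_at_right_less[of "0::real"] by eventually_elim (simp add: flat_def)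
    qed
    moreover have "((\<lambda>h. flat p h / h) \<longlongrightarrow> 0) (at_left 0)"
    proof (rule Lim_transform_eventually[OF tendsto_const])
      show "\<forall>\<^sub>F h in at_left 0. 0 = flat p h / h"
        by (auto simp: eventually_at_filter flat_def)
    qed
    ultimately have "((\<lambda>h. flat p h / h) \<longlongrightarrow> 0) (at 0)"
      by (rule filterlim_split_at[rotated])
    then show ?thesis
      using 3 by (simp add: DERIV_def flat_def)
  qed
qed

text \<open>A family that is closed under linear combinations and under differentiation, so that all its members are
  smooth. The polynomial factors \<open>r\<close> absorb what the chain rule produces from the inner polynomial \<open>s\<close>.\<close>

inductive_set bump_span :: "(real \<Rightarrow> real) set" where
  atom: "(\<lambda>x. poly r x * flat p (poly s x)) \<in> bump_span"
| add: "f \<in> bump_span \<Longrightarrow> g \<in> bump_span \<Longrightarrow> (\<lambda>x. f x + g x) \<in> bump_span"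

lemma bump_span_cmult: "f \<in> bump_span \<Longrightarrow> (\<lambda>x. k * f x) \<in> bump_span"
proof (induction rule: bump_span.induct)
  case (atom r p s)
  then show ?case
    using bump_span.atom[of "smult k r" p s] by (simp add: mult.assoc)
next
  case (add f g)
  then show ?case
    using bump_span.add[OF add.IH] by (simp add: distrib_left)
qed

lemma bump_span_DERIV:
  assumes "f \<in> bump_span"
  shows "\<exists>g\<in>bump_span. \<forall>x. (f has_real_derivative g x) (at x)"
  using assms
proof (induction rule: bump_span.induct)
  case (atom r p s)
  define q where "q = [:0, 0, 1:] * (p - pderiv p)"
  show ?case
  proof (intro bexI allI)
    show "(\<lambda>x. poly (pderiv r) x * flat p (poly s x) + poly (r * pderiv s) x * flat q (poly s x))
        \<in> bump_span"
      by (intro bump_span.intros)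
    fix x
    have "((\<lambda>x. flat p (poly s x)) has_real_derivative flat q (poly s x) * poly (pderiv s) x) (at x)"
      unfolding q_def by (rule DERIV_chain2[OF DERIV_flat poly_DERIV])
    from DERIV_mult[OF poly_DERIV this]
    show "((\<lambda>x. poly r x * flat p (poly s x)) has_real_derivative
        poly (pderiv r) x * flat p (poly s x) + poly (r * pderiv s) x * flat q (poly s x)) (at x)"
      by (simp add: mult_ac)
  qed
next
  case (add f g)
  then obtain f' g' where "f' \<in> bump_span" "g' \<in> bump_span"
    "\<And>x. (f has_real_derivative f' x) (at x)" "\<And>x. (g has_real_derivative g' x) (at x)"
    by blast
  then show ?case
    by (intro bexI[of _ "\<lambda>x. f' x + g' x"]) (auto intro: bump_span.add DERIV_add)
qed

lemma bump_span_deriv: "f \<in> bump_span \<Longrightarrow> deriv f \<in> bump_span"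
  using bump_span_DERIV[of f] by (metis DERIV_imp_deriv ext)

lemma bump_span_differentiable:
  assumes "f \<in> bump_span"
  shows "f differentiable (at x)"
  using bump_span_DERIV[OF assms] by (auto simp: real_differentiable_def)

lemma bump_span_higher_deriv:
  assumes "f \<in> bump_span"
  shows "(deriv ^^ n) f \<in> bump_span"
  using assms by (induction n) (auto intro: bump_span_deriv)

lemma bump_span_continuous_on: "f \<in> bump_span \<Longrightarrow> continuous_on A f"
  by (meson bump_span_differentiable continuous_at_imp_continuous_on differentiable_imp_continuous_within)

text \<open>The primitive \<open>\<integral> f\<close> over \<open>{a..x}\<close> vanishes to the left of the support of \<open>f\<close> for trivial reasons, and to
  the right of it because \<open>f\<close> has integral zero; hence it has compact support in the open interval.\<close>

lemma exists_test_fun_antiderivative: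
  assumes f: "f \<in> bump_span" and cd: "a < c" "c \<le> d" "d < b"
    and supp: "\<And>x. x \<notin> {c..d} \<Longrightarrow> f x = 0" and zero: "integral {a..b} f = 0"
  shows "\<exists>\<phi>. test_fun a b \<phi> \<and> deriv \<phi> = f"
proof -
  define \<phi> where "\<phi> x = integral {a..x} f" for x
  have cont: "continuous_on A f" for A
    by (rule bump_span_continuous_on[OF f])
  have left: "\<phi> x = 0" if "x < c" for x
    unfolding \<phi>_def by (rule integral_unique, rule has_integral_is_0) (use that in \<open>auto intro: supp\<close>)
  have "\<phi> x = \<phi> d" if "d \<le> x" for x
  proof -
    have "integral {d..x} f = 0"
    proof (rule integral_unique, rule has_integral_spike_finite[OF _ _ has_integral_0])
      show "f y = 0" if "y \<in> {d..x} - {d}" for y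
        using that by (intro supp) auto
    qed simp
    moreover have "integral {a..d} f + integral {d..x} f = integral {a..x} f"
      by (rule Henstock_Kurzweil_Integration.integral_combine)
         (use that cd in \<open>auto intro!: integrable_continuous_real cont\<close>)
    ultimately show ?thesis
      by (simp add: \<phi>_def)
  qed
  moreover have "\<phi> b = 0"
    using zero by (simp add: \<phi>_def)
  ultimately have right: "\<phi> x = 0" if "d \<le> x" for x
    using that cd by (metis less_imp_le)
  have D: "(\<phi> has_real_derivative f x) (at x)" for x
  proof (cases "x < c")
    case True
    then have "((\<lambda>x. 0) has_real_derivative f x) (at x)"
      using supp[of x] by simp
    then show ?thesis
      by (rule has_field_derivative_transform_within_open[where S = "{..<c}"])
         (use True left in auto)
  next
    case False
    \<comment> \<open>Here \<open>a < c \<le> x\<close>, so that \<open>x\<close> is an interior point of \<open>{a..x + 1}\<close>.\<close>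
    then have "(\<phi> has_real_derivative f x) (at x within {a..x + 1})"
      unfolding \<phi>_def using cd by (intro integral_has_real_derivative cont) auto
    moreover have "at x within {a..x + 1} = at x"
      by (rule at_within_interior) (use False cd in auto)
    ultimately show ?thesis by simp
  qed
  then have deriv: "deriv \<phi> = f"
    by (intro ext DERIV_imp_deriv)
  have "(deriv ^^ n) \<phi> differentiable (at x)" for n x
  proof (cases n)
    case 0
    then show ?thesis using D by (auto simp: real_differentiable_def)
  next
    case (Suc m)
    then have "(deriv ^^ n) \<phi> = (deriv ^^ m) f"
      by (simp add: funpow_swap1 deriv)
    then show ?thesis
      using bump_span_differentiable[OF bump_span_higher_deriv[OF f]] by simp
  qed
  moreover have "closure {x. \<phi> x \<noteq> 0} \<subseteq> {c..d}"
  proof (rule closure_minimal)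
    show "{x. \<phi> x \<noteq> 0} \<subseteq> {c..d}"
      using left right by (metis (mono_tags, lifting) atLeastAtMost_iff linorder_le_cases mem_Collect_eq
          not_less subsetI)
  qed simp
  ultimately have "test_fun a b \<phi>"
    unfolding test_fun_def using cd by auto
  with deriv show ?thesis by blast
qed

text \<open>The parameter \<open>n\<close> scales the argument, so that the support stays \<open>{c..d}\<close> while the values increase to \<open>1\<close>
  on the open interval as \<open>n\<close> grows.\<close>

definition bump :: "real \<Rightarrow> real \<Rightarrow> nat \<Rightarrow> real \<Rightarrow> real" where
  "bump c d n x = flat 1 (real (Suc n) * ((x - c) * (d - x)))"

lemma bump_eq_0:
  assumes "x \<notin> {c<..<d}" "c \<le> d"
  shows "bump c d n x = 0"
proof -
  have "(x - c) * (d - x) \<le> 0"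
    using assms by (auto simp: mult_le_0_iff)
  then have "real (Suc n) * ((x - c) * (d - x)) \<le> 0"
    by (rule mult_nonneg_nonpos[rotated]) simp
  then show ?thesis
    by (simp only: bump_def flat_def not_less[symmetric] if_False)
qed

lemma bump_pos: "x \<in> {c<..<d} \<Longrightarrow> bump c d n x > 0"
  by (auto simp: bump_def flat_def)

lemma bump_nonneg: "0 \<le> bump c d n x"
  by (simp add: bump_def flat_def)

lemma bump_le_1: "bump c d n x \<le> 1"
  by (simp add: bump_def flat_def)

lemma bump_in_span: "bump c d n \<in> bump_span"
proof -
  have "poly (smult (real (Suc n)) ([:- c, 1:] * [:d, - 1:])) x = real (Suc n) * ((x - c) * (d - x))" for x
    by (simp add: algebra_simps)
  then have "bump c d n = (\<lambda>x. poly 1 x * flat 1 (poly (smult (real (Suc n)) ([:- c, 1:] * [:d, - 1:])) x))"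
    by (simp only: bump_def[abs_def] poly_1 mult_1)
  then show ?thesis
    by (simp only: bump_span.atom)
qed

lemma bump_tendsto_indicator:
  assumes "c \<le> d"
  shows "(\<lambda>n. bump c d n x) \<longlonglongrightarrow> indicator {c<..<d} x"
proof (cases "x \<in> {c<..<d}")
  case True
  then have q: "(x - c) * (d - x) > 0" by simp
  have "(\<lambda>n. inverse (real (Suc n)) * inverse ((x - c) * (d - x))) \<longlonglongrightarrow> 0 * inverse ((x - c) * (d - x))"
    by (intro tendsto_intros LIMSEQ_inverse_real_of_nat)
  then have "(\<lambda>n. exp (- (inverse (real (Suc n)) * inverse ((x - c) * (d - x))))) \<longlonglongrightarrow> exp (- 0)"
    by (intro tendsto_intros) simp
  moreover have "bump c d n x = exp (- (inverse (real (Suc n)) * inverse ((x - c) * (d - x))))" for n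
  proof -
    have "real (Suc n) * ((x - c) * (d - x)) > 0"
      by (rule mult_pos_pos[OF _ q]) simp
    then show ?thesis
      unfolding bump_def flat_def by (simp only: if_True poly_1 mult_1 divide_inverse inverse_mult_distrib)
  qed
  ultimately show ?thesis
    using True by simp
next
  case False
  then show ?thesis
    using bump_eq_0[OF False assms] by simp
qed

lemma integral_bump_pos:
  assumes "a < c" "c < d" "d < b"
  shows "integral {a..b} (bump c d n) > 0"
proof -
  have cont: "continuous_on {a..b} (bump c d n)"
    by (intro bump_span_continuous_on bump_in_span)
  have "integral {a..b} (bump c d n) \<noteq> 0"
  proof
    assume "integral {a..b} (bump c d n) = 0"
    then have "\<forall>x\<in>{a..b}. bump c d n x = 0"
      using assms by (subst (asm) integral_eq_0_iff[OF cont]) (auto simp: bump_nonneg)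
    moreover have "(c + d) / 2 \<in> {a..b}" "(c + d) / 2 \<in> {c<..<d}"
      using assms by auto
    ultimately show False
      using bump_pos[of "(c + d) / 2" c d n] by simp
  qed
  moreover have "integral {a..b} (bump c d n) \<ge> 0"
    by (rule Henstock_Kurzweil_Integration.integral_nonneg)
       (auto intro: integrable_continuous_real cont bump_nonneg)
  ultimately show ?thesis by simp
qed

text \<open>Testing against bumps recovers the integrals over all intervals: the bumps are bounded by \<open>1\<close> and
  converge to the indicator function, so the dominated convergence theorem applies.\<close>

lemma tendsto_integral_mult_bump:
  fixes w :: "real \<Rightarrow> real"
  assumes w: "integrable (lebesgue_on {a..b}) w" and cd: "a \<le> c" "c \<le> d" "d \<le> b"
  shows "(\<lambda>n. \<integral>x. w x * bump c d n x \<partial>lebesgue_on {a..b}) \<longlonglongrightarrow> integral\<^sup>L (lebesgue_on {c..d}) w"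
proof -
  have [measurable]: "w \<in> borel_measurable (lebesgue_on {a..b})"
    using w by simp
  have [measurable]: "bump c d n \<in> borel_measurable (lebesgue_on {a..b})" for n
    by (intro continuous_imp_measurable_on_sets_lebesgue bump_span_continuous_on bump_in_span) auto
  have [measurable]: "indicator {c<..<d} \<in> borel_measurable (lebesgue_on {a..b})"
    by (intro borel_measurable_indicator) (use cd in \<open>auto simp: sets_restrict_space_iff\<close>)
  have "(\<lambda>n. \<integral>x. w x * bump c d n x \<partial>lebesgue_on {a..b})
      \<longlonglongrightarrow> (\<integral>x. w x * indicator {c<..<d} x \<partial>lebesgue_on {a..b})"
  proof (rule integral_dominated_convergence)
    show "integrable (lebesgue_on {a..b}) (\<lambda>x. \<bar>w x\<bar>)"
      using w by simp
    show "AE x in lebesgue_on {a..b}. (\<lambda>n. w x * bump c d n x) \<longlonglongrightarrow> w x * indicator {c<..<d} x"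
      by (intro AE_I2 tendsto_intros bump_tendsto_indicator cd)
    show "AE x in lebesgue_on {a..b}. norm (w x * bump c d n x) \<le> \<bar>w x\<bar>" for n
      by (intro AE_I2) (auto simp: abs_mult bump_nonneg bump_le_1 intro: mult_left_le)
  qed measurable
  also have "(\<integral>x. w x * indicator {c<..<d} x \<partial>lebesgue_on {a..b}) = integral\<^sup>L (lebesgue_on {c..d}) w"
  proof -
    have "(\<integral>x. w x * indicator {c<..<d} x \<partial>lebesgue_on {a..b})
        = (\<integral>x. indicator {a..b} x *\<^sub>R (w x * indicator {c<..<d} x) \<partial>lebesgue)"
      by (rule integral_restrict_space) auto
    also have "\<dots> = (\<integral>x. indicator {c<..<d} x *\<^sub>R w x \<partial>lebesgue)"
      by (rule Bochner_Integration.integral_cong) (use cd in \<open>auto simp: indicator_def\<close>)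
    also have "\<dots> = (\<integral>x. indicator {c..d} x *\<^sub>R w x \<partial>lebesgue)"
    proof (rule integral_cong_AE)
      have "integrable (lebesgue_on {c..d}) w"
        by (rule Equivalence_Lebesgue_Henstock_Integration.integrable_subinterval[OF w]) (use cd in auto)
      then show meas: "(\<lambda>x. indicator {c..d} x *\<^sub>R w x) \<in> borel_measurable lebesgue"
        by (subst (asm) integrable_restrict_space) auto
      have "(\<lambda>x. indicator {c<..<d} x *\<^sub>R (indicator {c..d} x *\<^sub>R w x)) \<in> borel_measurable lebesgue"
        by (intro borel_measurable_scaleR meas borel_measurable_indicator) auto
      moreover have "indicator {c<..<d} x *\<^sub>R (indicator {c..d} x *\<^sub>R w x) = indicator {c<..<d} x *\<^sub>R w x" for x
        by (simp add: indicator_def)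
      ultimately show "(\<lambda>x. indicator {c<..<d} x *\<^sub>R w x) \<in> borel_measurable lebesgue"
        by (simp only:)
      have "AE x in lebesgue. x \<notin> {c, d}"
        by (rule AE_not_in) (simp flip: negligible_iff_null_sets)
      then show "AE x in lebesgue. indicator {c<..<d} x *\<^sub>R w x = indicator {c..d} x *\<^sub>R w x"
        by eventually_elim (auto simp: indicator_def)
    qed
    also have "\<dots> = integral\<^sup>L (lebesgue_on {c..d}) w"
      by (rule integral_restrict_space[symmetric]) auto
    finally show ?thesis .
  qed
  finally show ?thesis .
qed

text \<open>The lemma of du Bois-Reymond. Fix a bump \<open>\<psi>\<close> with integral \<open>I > 0\<close>. Every other bump differs from a
  multiple of \<open>\<psi>\<close> by a function with integral zero, which is the derivative of a test function. Hence \<open>w\<close> acts on all bumps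
  like the constant \<open>k\<close> for which this is true of \<open>\<psi>\<close>, and bumps separate integrable functions.\<close>

lemma AE_const_if_orthogonal_to_test_fun_derivs:
  fixes w :: "real \<Rightarrow> real"
  assumes ab: "a < b" and w: "integrable (lebesgue_on {a..b}) w"
    and orth: "\<And>\<phi>. test_fun a b \<phi> \<Longrightarrow> (\<integral>x. w x * deriv \<phi> x \<partial>lebesgue_on {a..b}) = 0"
  shows "\<exists>k. AE x in lebesgue_on {a..b}. w x = k"
proof -
  let ?M = "lebesgue_on {a..b}"
  have int: "integrable ?M f" and intw: "integrable ?M (\<lambda>x. w x * f x)"
    and HK: "integral\<^sup>L ?M f = integral {a..b} f" if "f \<in> bump_span" for f
  proof -
    have c: "continuous_on {a..b} f"
      using that by (rule bump_span_continuous_on)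
    show i: "integrable ?M f"
      by (rule continuous_imp_integrable_real[OF c])
    show "integrable ?M (\<lambda>x. w x * f x)"
      using integrable_continuous_mult[OF c w] by (simp add: mult.commute)
    show "integral\<^sup>L ?M f = integral {a..b} f"
      by (rule lebesgue_integral_eq_integral[OF i]) auto
  qed
  define c0 d0 where "c0 = a + (b - a) / 3" and "d0 = a + 2 * (b - a) / 3"
  have cd0: "a < c0" "c0 < d0" "d0 < b"
    using ab by (auto simp: c0_def d0_def field_simps)
  define \<psi> where "\<psi> = bump c0 d0 0"
  have \<psi>: "\<psi> \<in> bump_span"
    by (simp add: \<psi>_def bump_in_span)
  define I where "I = integral\<^sup>L ?M \<psi>"
  have I: "I > 0"
    unfolding I_def HK[OF \<psi>] using integral_bump_pos[OF cd0] by (simp add: \<psi>_def)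
  define k where "k = (\<integral>x. w x * \<psi> x \<partial>?M) / I"
  have "AE x in ?M. w x - k = 0"
  proof (rule AE_eq_0_if_interval_integrals_eq_0)
    show wk: "integrable ?M (\<lambda>x. w x - k)"
      using w by simp
    fix c d assume cd: "a < c" "c < d" "d < b"
    have zero: "(\<integral>x. (w x - k) * bump c d n x \<partial>?M) = 0" for n
    proof -
      have b: "bump c d n \<in> bump_span"
        by (rule bump_in_span)
      define J where "J = integral\<^sup>L ?M (bump c d n)"
      define f where "f x = bump c d n x + (- (J / I)) * \<psi> x" for x
      have f: "f \<in> bump_span"
        unfolding f_def[abs_def] by (intro bump_span.add bump_span_cmult b \<psi>)
      have "integral\<^sup>L ?M f = J - J / I * I"
        using int[OF b] int[OF \<psi>] by (simp add: f_def[abs_def] J_def I_def)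
      then have "integral {a..b} f = 0"
        using I HK[OF f] by simp
      moreover have "f x = 0" if "x \<notin> {min c c0..max d d0}" for x
      proof -
        have "bump c d n x = 0" "bump c0 d0 0 x = 0"
          using that cd cd0 by (auto intro!: bump_eq_0)
        then show ?thesis
          by (simp add: f_def \<psi>_def)
      qed
      ultimately obtain \<phi> where "test_fun a b \<phi>" "deriv \<phi> = f"
        using exists_test_fun_antiderivative[OF f, of a "min c c0" "max d d0" b] cd cd0
        by (auto simp: min_le_iff_disj le_max_iff_disj)
      then have "(\<integral>x. w x * f x \<partial>?M) = 0"
        using orth by blast
      moreover have "(\<integral>x. w x * f x \<partial>?M)
          = (\<integral>x. w x * bump c d n x \<partial>?M) + (- (J / I)) * (\<integral>x. w x * \<psi> x \<partial>?M)"
      proof -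
        have "(\<integral>x. w x * f x \<partial>?M) = (\<integral>x. w x * bump c d n x + (- (J / I)) * (w x * \<psi> x) \<partial>?M)"
          by (rule Bochner_Integration.integral_cong) (auto simp: f_def algebra_simps)
        also have "\<dots> = (\<integral>x. w x * bump c d n x \<partial>?M) + (\<integral>x. (- (J / I)) * (w x * \<psi> x) \<partial>?M)"
          by (intro Bochner_Integration.integral_add integrable_mult_right intw b \<psi>)
        finally show ?thesis
          by simp
      qed
      ultimately have "(\<integral>x. w x * bump c d n x \<partial>?M) = k * J"
        by (simp add: k_def)
      then show ?thesis
        using intw[OF b] int[OF b] by (simp add: left_diff_distrib J_def)
    qed
    have "(\<lambda>n. \<integral>x. (w x - k) * bump c d n x \<partial>?M) \<longlonglongrightarrow> (\<integral>x. w x - k \<partial>lebesgue_on {c..d})"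
      using tendsto_integral_mult_bump[OF wk, of c d] cd by simp
    then show "(\<integral>x. w x - k \<partial>lebesgue_on {c..d}) = 0"
      unfolding zero using LIMSEQ_unique[OF tendsto_const] by metis
  qed
  then show ?thesis
    by (intro exI[of _ k]) auto
qed

section \<open>Weak derivatives and absolutely continuous representatives\<close>

lemma square_integrable_imp_integrable:
  assumes "f \<in> square_integrable a b"
  shows "integrable (lebesgue_on {a..b}) f"
proof (rule Bochner_Integration.integrable_bound)
  show "integrable (lebesgue_on {a..b}) (\<lambda>x. 1 + (f x)\<^sup>2)"
    using assms by (auto simp: square_integrable_def)
  show "AE x in lebesgue_on {a..b}. norm (f x) \<le> norm (1 + (f x)\<^sup>2)"
  proof (rule AE_I2)
    fix x
    \<comment> \<open>Completing the square shows that \<open>1 + y\<^sup>2 - y\<close> is positive.\<close>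
    have "0 \<le> (\<bar>f x\<bar> - 1 / 2)\<^sup>2" by simp
    then show "norm (f x) \<le> norm (1 + (f x)\<^sup>2)"
      by (simp add: power2_eq_square algebra_simps)
  qed
qed (use assms in \<open>auto simp: square_integrable_def\<close>)

lemma continuous_on_square_integrable:
  assumes "continuous_on {a..b} f"
  shows "f \<in> square_integrable a b"
  unfolding square_integrable_def
proof (intro CollectI conjI)
  show "f \<in> borel_measurable (lebesgue_on {a..b})"
    by (rule continuous_imp_measurable_on_sets_lebesgue[OF assms]) auto
  show "integrable (lebesgue_on {a..b}) (\<lambda>x. (f x)\<^sup>2)"
    by (intro continuous_imp_integrable_real continuous_intros assms)
qed

lemma square_integrable_diff:
  assumes f: "f \<in> square_integrable a b" and g: "g \<in> square_integrable a b"
  shows "(\<lambda>x. f x - g x) \<in> square_integrable a b"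
  unfolding square_integrable_def
proof (intro CollectI conjI)
  have m[measurable]: "f \<in> borel_measurable (lebesgue_on {a..b})" "g \<in> borel_measurable (lebesgue_on {a..b})"
    using f g by (auto simp: square_integrable_def)
  show "(\<lambda>x. f x - g x) \<in> borel_measurable (lebesgue_on {a..b})"
    by measurable
  show "integrable (lebesgue_on {a..b}) (\<lambda>x. (f x - g x)\<^sup>2)"
  proof (rule Bochner_Integration.integrable_bound)
    show "integrable (lebesgue_on {a..b}) (\<lambda>x. 2 * (f x)\<^sup>2 + 2 * (g x)\<^sup>2)"
      using f g by (auto simp: square_integrable_def)
    show "AE x in lebesgue_on {a..b}. norm ((f x - g x)\<^sup>2) \<le> norm (2 * (f x)\<^sup>2 + 2 * (g x)\<^sup>2)"
    proof (rule AE_I2)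
      fix x
      have "(f x - g x)\<^sup>2 + (f x + g x)\<^sup>2 = 2 * (f x)\<^sup>2 + 2 * (g x)\<^sup>2"
        by (simp add: power2_eq_square algebra_simps)
      then show "norm ((f x - g x)\<^sup>2) \<le> norm (2 * (f x)\<^sup>2 + 2 * (g x)\<^sup>2)"
        using zero_le_power2[of "f x + g x"] zero_le_power2[of "f x - g x"]
        unfolding real_norm_def by linarith
    qed
  qed measurable
qed

lemma square_integrable_add:
  assumes f: "f \<in> square_integrable a b" and g: "g \<in> square_integrable a b"
  shows "(\<lambda>x. f x + g x) \<in> square_integrable a b"
proof -
  have "(\<lambda>x. - g x) \<in> square_integrable a b"
    using g by (auto simp: square_integrable_def)
  from square_integrable_diff[OF f this] show ?thesis by simp
qed

lemma l2_class_eq_iff: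
  assumes "f \<in> square_integrable a b" "g \<in> square_integrable a b"
  shows "l2_class a b f = l2_class a b g \<longleftrightarrow> (AE x in lebesgue_on {a..b}. f x = g x)"
  using l2_class_self[OF assms(1)] l2_class_cong[where f = f and g = g] by (auto simp: l2_class_def)

lemma cont_rep_l2_class:
  assumes "a < b" "continuous_on {a..b} f" "x \<in> {a..b}"
  shows "cont_rep a b (l2_class a b f) x = f x"
proof -
  have f: "f \<in> square_integrable a b"
    by (rule continuous_on_square_integrable[OF assms(2)])
  then have "l2_class a b f \<in> L2 a b"
    by (simp add: L2_def)
  then show ?thesis
    using l2_class_self[OF f] by (intro cont_rep_eq assms)
qed

lemma test_funD:
  assumes "test_fun a b \<phi>"
  shows "(\<phi> has_real_derivative deriv \<phi> x) (at x)"
    and "continuous_on A (deriv \<phi>)" and "continuous_on A \<phi>"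
    and "x \<notin> {a<..<b} \<Longrightarrow> \<phi> x = 0"
proof -
  have d: "\<phi> differentiable (at x)" "deriv \<phi> differentiable (at x)" for x
    using assms[unfolded test_fun_def, THEN conjunct1, rule_format, of 0 x]
      assms[unfolded test_fun_def, THEN conjunct1, rule_format, of 1 x] by auto
  then show "(\<phi> has_real_derivative deriv \<phi> x) (at x)"
    by (simp add: DERIV_deriv_iff_real_differentiable)
  show "continuous_on A (deriv \<phi>)" "continuous_on A \<phi>"
    using d by (auto intro!: continuous_at_imp_continuous_on differentiable_imp_continuous_within)
  show "\<phi> x = 0" if "x \<notin> {a<..<b}"
    using assms that closure_subset[of "{x. \<phi> x \<noteq> 0}"] by (auto simp: test_fun_def)
qed

lemma ac_with_deriv_test_fun: "test_fun a b \<phi> \<Longrightarrow> ac_with_deriv c d \<phi> (deriv \<phi>)"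
  by (intro ac_with_deriv_C1 test_funD)

lemma is_weak_deriv_l2_class_iff:
  assumes u: "u \<in> square_integrable a b" and v: "v \<in> square_integrable a b"
  shows "is_weak_deriv a b (l2_class a b u) (l2_class a b v) \<longleftrightarrow>
    (\<forall>\<phi>. test_fun a b \<phi> \<longrightarrow>
       (\<integral>x. u x * deriv \<phi> x \<partial>lebesgue_on {a..b}) = - (\<integral>x. v x * \<phi> x \<partial>lebesgue_on {a..b}))"
proof -
  have *: "(\<integral>x. l2_rep (l2_class a b w) x * g x \<partial>lebesgue_on {a..b})
      = (\<integral>x. w x * g x \<partial>lebesgue_on {a..b})"
    if "w \<in> square_integrable a b" "continuous_on {a..b} g" for w g
  proof -
    have [measurable]: "g \<in> borel_measurable (lebesgue_on {a..b})"
      by (rule continuous_imp_measurable_on_sets_lebesgue[OF that(2)]) auto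
    have [measurable]: "w \<in> borel_measurable (lebesgue_on {a..b})"
      "l2_rep (l2_class a b w) \<in> borel_measurable (lebesgue_on {a..b})"
      using that(1) l2_rep_class(1)[OF that(1)] by (auto simp: square_integrable_def)
    show ?thesis
    proof (rule integral_cong_AE)
      show "AE x in lebesgue_on {a..b}. l2_rep (l2_class a b w) x * g x = w x * g x"
        using l2_rep_class(2)[OF that(1)] by eventually_elim simp
    qed measurable
  qed
  have "(\<integral>x. l2_rep (l2_class a b u) x * deriv \<phi> x \<partial>lebesgue_on {a..b})
        = - (\<integral>x. l2_rep (l2_class a b v) x * \<phi> x \<partial>lebesgue_on {a..b}) \<longleftrightarrow>
      (\<integral>x. u x * deriv \<phi> x \<partial>lebesgue_on {a..b}) = - (\<integral>x. v x * \<phi> x \<partial>lebesgue_on {a..b})"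
    if "test_fun a b \<phi>" for \<phi>
    by (simp only: *[OF u test_funD(2)[OF that]] *[OF v test_funD(3)[OF that]])
  then show ?thesis
    unfolding is_weak_deriv_def by blast
qed

text \<open>Integration by parts; the boundary terms vanish because test functions vanish at \<open>a\<close> and \<open>b\<close>.\<close>

lemma ac_with_deriv_imp_is_weak_deriv:
  assumes "a < b" and f: "ac_with_deriv a b f v" and v: "v \<in> square_integrable a b"
  shows "is_weak_deriv a b (l2_class a b f) (l2_class a b v)"
proof -
  have fs: "f \<in> square_integrable a b"
    by (rule continuous_on_square_integrable[OF ac_with_deriv_continuous_on[OF f]])
  show ?thesis
    unfolding is_weak_deriv_l2_class_iff[OF fs v]
  proof (intro allI impI)
    fix \<phi> assume \<phi>: "test_fun a b \<phi>"
    have "(\<integral>x. f x * deriv \<phi> x + \<phi> x * v x \<partial>lebesgue_on {a..b}) = f b * \<phi> b - f a * \<phi> a"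
      using assms(1) by (intro ac_with_deriv_integration_by_parts f ac_with_deriv_test_fun[OF \<phi>]) simp
    also have "\<dots> = 0"
      using test_funD(4)[OF \<phi>] by simp
    also have "(\<integral>x. f x * deriv \<phi> x + \<phi> x * v x \<partial>lebesgue_on {a..b})
        = (\<integral>x. f x * deriv \<phi> x \<partial>lebesgue_on {a..b}) + (\<integral>x. \<phi> x * v x \<partial>lebesgue_on {a..b})"
      by (intro Bochner_Integration.integral_add integrable_continuous_mult
          ac_with_derivD(1)[OF f] ac_with_deriv_continuous_on[OF f] test_funD[OF \<phi>]
          continuous_imp_integrable_real)
    finally show "(\<integral>x. f x * deriv \<phi> x \<partial>lebesgue_on {a..b}) = - (\<integral>x. v x * \<phi> x \<partial>lebesgue_on {a..b})"
      by (simp add: mult.commute)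
  qed
qed

text \<open>The primitive \<open>F\<close> of \<open>v\<close> has the weak derivative \<open>v\<close> as well. So \<open>u - F\<close> is orthogonal to all derivatives of
  test functions and is constant by the lemma of du Bois-Reymond; \<open>F\<close> plus this constant is the
  continuous representative of \<open>u\<close>.\<close>

lemma is_weak_deriv_imp_ac_with_deriv:
  assumes ab: "a < b" and u: "u \<in> square_integrable a b" and v: "v \<in> square_integrable a b"
    and weak: "is_weak_deriv a b (l2_class a b u) (l2_class a b v)"
  shows "\<exists>f. ac_with_deriv a b f v \<and> l2_class a b u = l2_class a b f"
proof -
  let ?M = "lebesgue_on {a..b}"
  define F where "F x = integral\<^sup>L (lebesgue_on {a..x}) v" for x
  have Fa: "F a = 0"
    by (simp add: F_def integral_lebesgue_on_singleton)
  have F: "ac_with_deriv a b F v"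
    unfolding ac_with_deriv_def using Fa square_integrable_imp_integrable[OF v]
    by (simp add: F_def)
  have Fs: "F \<in> square_integrable a b"
    by (rule continuous_on_square_integrable[OF ac_with_deriv_continuous_on[OF F]])
  have "\<exists>k. AE x in ?M. u x - F x = k"
  proof (rule AE_const_if_orthogonal_to_test_fun_derivs[OF ab])
    show "integrable ?M (\<lambda>x. u x - F x)"
      using square_integrable_imp_integrable[OF u] square_integrable_imp_integrable[OF Fs] by simp
    fix \<phi> assume \<phi>: "test_fun a b \<phi>"
    have i: "integrable ?M (\<lambda>x. w x * deriv \<phi> x)" if "w \<in> square_integrable a b" for w
      using integrable_continuous_mult[OF test_funD(2)[OF \<phi>] square_integrable_imp_integrable[OF that]]
      by (simp add: mult.commute)
    have "(\<integral>x. u x * deriv \<phi> x \<partial>?M) = (\<integral>x. F x * deriv \<phi> x \<partial>?M)"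
      using weak ac_with_deriv_imp_is_weak_deriv[OF ab F v] \<phi>
      by (simp add: is_weak_deriv_l2_class_iff u v Fs)
    then show "(\<integral>x. (u x - F x) * deriv \<phi> x \<partial>?M) = 0"
      using i[OF u] i[OF Fs] by (simp add: left_diff_distrib)
  qed
  then obtain k where k: "AE x in ?M. u x - F x = k" by blast
  have "ac_with_deriv a b (\<lambda>x. F x + k) v"
    using F by (simp add: ac_with_deriv_def Fa F_def)
  moreover have "l2_class a b u = l2_class a b (\<lambda>x. F x + k)"
    by (rule l2_class_cong) (use k in eventually_elim, auto)
  ultimately show ?thesis by blast
qed

text \<open>The description of the weak derivative through representatives, which replaces test functions in all that
  follows.\<close>

lemma weak_deriv_op_iff:
  assumes "a < b"
  shows "(U, V) \<in> weak_deriv_op a b \<longleftrightarrow>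
    (\<exists>f v. ac_with_deriv a b f v \<and> v \<in> square_integrable a b \<and>
       U = l2_class a b f \<and> V = l2_class a b v)"
proof
  assume "(U, V) \<in> weak_deriv_op a b"
  then obtain u v where "u \<in> square_integrable a b" "v \<in> square_integrable a b"
    "U = l2_class a b u" "V = l2_class a b v" "is_weak_deriv a b U V"
    by (auto simp: weak_deriv_op_def H1_def L2_def)
  then show "\<exists>f v. ac_with_deriv a b f v \<and> v \<in> square_integrable a b \<and>
       U = l2_class a b f \<and> V = l2_class a b v"
    using is_weak_deriv_imp_ac_with_deriv[OF assms, of u v] by metis
next
  assume "\<exists>f v. ac_with_deriv a b f v \<and> v \<in> square_integrable a b \<and>
       U = l2_class a b f \<and> V = l2_class a b v"
  then obtain f v where fv: "ac_with_deriv a b f v" "v \<in> square_integrable a b"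
    "U = l2_class a b f" "V = l2_class a b v" by blast
  moreover have "f \<in> square_integrable a b"
    by (rule continuous_on_square_integrable[OF ac_with_deriv_continuous_on[OF fv(1)]])
  ultimately show "(U, V) \<in> weak_deriv_op a b"
    using ac_with_deriv_imp_is_weak_deriv[OF assms fv(1,2)]
    by (auto simp: weak_deriv_op_def H1_def L2_def)
qed

lemma H1_eq_Domain: "H1 a b = Domain (weak_deriv_op a b)"
  by (auto simp: weak_deriv_op_def H1_def)

text \<open>The difference of two derivatives of the same function has vanishing integrals over all intervals.\<close>

lemma ac_with_deriv_unique:
  assumes v: "ac_with_deriv a b f v" and w: "ac_with_deriv a b f w"
  shows "AE x in lebesgue_on {a..b}. v x = w x"
proof -
  have d: "ac_with_deriv a b (\<lambda>x. 0) (\<lambda>x. v x - w x)"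
    using ac_with_deriv_diff[OF v w] by simp
  then have i: "integrable (lebesgue_on {a..b}) (\<lambda>x. v x - w x)"
    by (rule ac_with_derivD(1))
  have "AE x in lebesgue_on {a..b}. v x - w x = 0"
  proof (rule AE_eq_0_if_interval_integrals_eq_0[OF i])
    fix c e assume ce: "a < c" "c < e" "e < b"
    have z: "(\<integral>x. v x - w x \<partial>lebesgue_on {a..x}) = 0" if "x \<in> {a..b}" for x
      using ac_with_derivD(2)[OF d that] by simp
    have "(\<integral>x. v x - w x \<partial>lebesgue_on {a..e})
        = (\<integral>x. v x - w x \<partial>lebesgue_on {a..c}) + (\<integral>x. v x - w x \<partial>lebesgue_on {c..e})"
      by (rule Equivalence_Measurable_On_Borel.integral_combine
          [OF integrable_lebesgue_on_subinterval[OF i]]) (use ce in auto)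
    then show "(\<integral>x. v x - w x \<partial>lebesgue_on {c..e}) = 0"
      using z[of c] z[of e] ce by simp
  qed
  then show ?thesis by simp
qed

section \<open>First-order equations and boundary coordinates\<close>

lemma ac_with_deriv_exp: "ac_with_deriv a b exp exp"
  by (intro ac_with_deriv_C1 DERIV_exp continuous_intros)

lemma ac_with_deriv_exp_minus: "ac_with_deriv a b (\<lambda>x. exp (- x)) (\<lambda>x. - exp (- x :: real))"
  by (intro ac_with_deriv_C1 continuous_intros) (auto intro!: derivative_eq_intros)

text \<open>The equation \<open>u + u' = f\<close> says that \<open>exp * u\<close> has the derivative \<open>exp * f\<close>.\<close>

lemma resolvent_equation_solution:
  assumes u: "ac_with_deriv a b u v" and eq: "AE x in lebesgue_on {a..b}. u x + v x = f x"
    and f: "integrable (lebesgue_on {a..b}) f" and x: "x \<in> {a..b}"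
  shows "exp x * u x = exp a * u a + (\<integral>t. exp t * f t \<partial>lebesgue_on {a..x})"
proof -
  have "ac_with_deriv a b (\<lambda>x. exp x * u x) (\<lambda>x. exp x * f x)"
  proof (rule ac_with_deriv_cong_AE[OF ac_with_deriv_mult[OF ac_with_deriv_exp u]])
    show "AE x in lebesgue_on {a..b}. exp x * v x + u x * exp x = exp x * f x"
      using eq by eventually_elim (simp add: algebra_simps flip: distrib_left)
    show "integrable (lebesgue_on {a..b}) (\<lambda>x. exp x * f x)"
      by (intro integrable_continuous_mult f continuous_intros)
  qed
  from ac_with_derivD(2)[OF this x] show ?thesis .
qed

text \<open>Variation of constants: the solution is \<open>exp (- x)\<close> times a primitive of \<open>exp * f\<close>.\<close>

lemma exists_resolvent_equation_solution:
  assumes f: "integrable (lebesgue_on {a..b}) f"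
  shows "\<exists>u. ac_with_deriv a b u (\<lambda>x. f x - u x) \<and> u a = k"
proof -
  define G where "G x = exp a * k + (\<integral>t. exp t * f t \<partial>lebesgue_on {a..x})" for x
  define u where "u x = exp (- x) * G x" for x
  have int: "integrable (lebesgue_on {a..b}) (\<lambda>x. exp x * f x)"
    by (intro integrable_continuous_mult f continuous_intros)
  have a: "G a = exp a * k"
    by (simp add: G_def integral_lebesgue_on_singleton)
  have G: "ac_with_deriv a b G (\<lambda>x. exp x * f x)"
    unfolding ac_with_deriv_def a using int by (simp add: G_def)
  have "ac_with_deriv a b u (\<lambda>x. exp (- x) * (exp x * f x) + G x * - exp (- x))"
    unfolding u_def[abs_def] by (rule ac_with_deriv_mult[OF ac_with_deriv_exp_minus G])
  moreover have "exp (- x) * (exp x * f x) + G x * - exp (- x) = f x - u x" for x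
    by (simp add: u_def exp_minus field_simps)
  moreover have "u a = k"
    by (simp add: u_def a exp_minus)
  ultimately show ?thesis by auto
qed

text \<open>The coefficient of \<open>exp (- x)\<close> in the combination of \<open>exp (- x)\<close> and \<open>exp x\<close> that takes the values
  \<open>s\<close> at \<open>a\<close> and \<open>t\<close> at \<open>b\<close>.\<close>

definition decaying_coeff :: "real \<Rightarrow> real \<Rightarrow> real \<Rightarrow> real \<Rightarrow> real" where
  "decaying_coeff a b s t = (s * exp (- a) - t * exp (- b)) / (exp (- 2 * a) - exp (- 2 * b))"

text \<open>The coefficient of \<open>exp x\<close> in the same combination.\<close>

definition growing_coeff :: "real \<Rightarrow> real \<Rightarrow> real \<Rightarrow> real \<Rightarrow> real" where
  "growing_coeff a b s t = (t * exp b - s * exp a) / (exp (2 * b) - exp (2 * a))"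

text \<open>This justifies the description of the two coefficients, which are given by Cramer's rule.\<close>

lemma boundary_values_from_coeffs:
  assumes "a < b"
  shows "s = growing_coeff a b s t * exp a + decaying_coeff a b s t * exp (- a)"
    and "t = growing_coeff a b s t * exp b + decaying_coeff a b s t * exp (- b)"
proof -
  define A B where "A = exp a" and "B = exp b"
  have AB: "0 < A" "A < B"
    using assms by (auto simp: A_def B_def)
  have e: "exp (- a) = 1 / A" "exp (- b) = 1 / B" "exp (2 * a) = A\<^sup>2" "exp (2 * b) = B\<^sup>2"
    "exp (- 2 * a) = 1 / A\<^sup>2" "exp (- 2 * b) = 1 / B\<^sup>2"
    by (simp_all add: A_def B_def exp_minus divide_inverse exp_double)
  have d: "B\<^sup>2 - A\<^sup>2 \<noteq> 0"
    using AB by (simp add: power_strict_mono)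
  have d': "1 / A\<^sup>2 - 1 / B\<^sup>2 = (B\<^sup>2 - A\<^sup>2) / (A\<^sup>2 * B\<^sup>2)"
    using AB by (simp add: field_simps)
  have g: "growing_coeff a b s t = (t * B - s * A) / (B\<^sup>2 - A\<^sup>2)"
    by (simp add: growing_coeff_def e flip: A_def B_def)
  have r: "decaying_coeff a b s t = A * B * (s * B - t * A) / (B\<^sup>2 - A\<^sup>2)"
    unfolding decaying_coeff_def e d' using AB d by (simp add: field_simps power2_eq_square)
  have *: "growing_coeff a b s t * A + decaying_coeff a b s t * (1 / A)
      = (A * (t * B - s * A) + B * (s * B - t * A)) / (B\<^sup>2 - A\<^sup>2)"
    "growing_coeff a b s t * B + decaying_coeff a b s t * (1 / B)
      = (B * (t * B - s * A) + A * (s * B - t * A)) / (B\<^sup>2 - A\<^sup>2)"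
    unfolding g r using AB by (auto simp: add_divide_distrib)
  have "A * (t * B - s * A) + B * (s * B - t * A) = s * (B\<^sup>2 - A\<^sup>2)"
    "B * (t * B - s * A) + A * (s * B - t * A) = t * (B\<^sup>2 - A\<^sup>2)"
    by (simp_all add: power2_eq_square algebra_simps)
  with * d show "s = growing_coeff a b s t * exp a + decaying_coeff a b s t * exp (- a)"
    "t = growing_coeff a b s t * exp b + decaying_coeff a b s t * exp (- b)"
    unfolding e A_def[symmetric] B_def[symmetric] by simp_all
qed

lemma growing_coeff_diff:
  "growing_coeff a b s t - growing_coeff a b s' t' = growing_coeff a b (s - s') (t - t')"
  by (simp add: growing_coeff_def algebra_simps flip: diff_divide_distrib)

lemma decaying_coeff_diff:
  "decaying_coeff a b s t - decaying_coeff a b s' t' = decaying_coeff a b (s - s') (t - t')"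
  by (simp add: decaying_coeff_def algebra_simps flip: diff_divide_distrib)

text \<open>The coordinates \<open>p\<close> and \<open>q\<close> diagonalise the boundary form: with \<open>A = exp a\<close> and \<open>B = exp b\<close>, the difference
  \<open>t\<^sup>2 - s\<^sup>2\<close> is a positive multiple of \<open>(A * B * q)\<^sup>2 - p\<^sup>2\<close>. This is where the Lipschitz constant \<open>exp (a + b)\<close>
  comes from.\<close>

lemma abs_boundary_le_iff:
  assumes "a < b"
  shows "s\<^sup>2 \<le> t\<^sup>2 \<longleftrightarrow> \<bar>decaying_coeff a b s t\<bar> \<le> exp (a + b) * \<bar>growing_coeff a b s t\<bar>"
proof -
  define A B where "A = exp a" and "B = exp b"
  define p q where "p = decaying_coeff a b s t" and "q = growing_coeff a b s t"
  have AB: "0 < A" "A < B"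
    using assms by (auto simp: A_def B_def)
  have st: "s = q * A + p / A" "t = q * B + p / B"
    using boundary_values_from_coeffs[OF assms, where s = s and t = t]
    by (simp_all add: p_def q_def A_def B_def exp_minus divide_inverse)
  have "t\<^sup>2 - s\<^sup>2 = (B\<^sup>2 - A\<^sup>2) / (A\<^sup>2 * B\<^sup>2) * ((A * B * q)\<^sup>2 - p\<^sup>2)"
    unfolding st using AB by (simp add: field_simps power2_eq_square)
  moreover have "(B\<^sup>2 - A\<^sup>2) / (A\<^sup>2 * B\<^sup>2) > 0"
    using AB by (simp add: power_strict_mono)
  ultimately have "s\<^sup>2 \<le> t\<^sup>2 \<longleftrightarrow> p\<^sup>2 \<le> (A * B * q)\<^sup>2"
    by (smt (verit) mult_nonneg_nonneg mult_pos_neg)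
  also have "\<dots> \<longleftrightarrow> \<bar>p\<bar> \<le> A * B * \<bar>q\<bar>"
    using AB by (simp add: abs_le_square_iff[symmetric] abs_mult)
  finally show ?thesis
    by (simp add: p_def q_def A_def B_def exp_add)
qed

text \<open>Integration by parts of \<open>u - v\<close> against itself: the inner product in the definition of accretivity only
  sees the boundary values.\<close>

lemma l2_inner_deriv_diff:
  assumes ab: "a < b" and u: "ac_with_deriv a b u x" "x \<in> square_integrable a b"
    and v: "ac_with_deriv a b v y" "y \<in> square_integrable a b"
  shows "l2_inner a b (l2_diff a b (l2_class a b x) (l2_class a b y))
      (l2_diff a b (l2_class a b u) (l2_class a b v))
    = ((u b - v b)\<^sup>2 - (u a - v a)\<^sup>2) / 2"
proof -
  have s: "u \<in> square_integrable a b" "v \<in> square_integrable a b"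
    using u(1) v(1) by (auto intro: continuous_on_square_integrable ac_with_deriv_continuous_on)
  have d: "ac_with_deriv a b (\<lambda>t. u t - v t) (\<lambda>t. x t - y t)"
    by (rule ac_with_deriv_diff[OF u(1) v(1)])
  have "l2_inner a b (l2_diff a b (l2_class a b x) (l2_class a b y))
      (l2_diff a b (l2_class a b u) (l2_class a b v))
      = (\<integral>t. (x t - y t) * (u t - v t) \<partial>lebesgue_on {a..b})"
    by (simp add: l2_diff_class l2_inner_class square_integrable_diff s u v)
  moreover have "2 * (\<integral>t. (x t - y t) * (u t - v t) \<partial>lebesgue_on {a..b})
      = (u b - v b)\<^sup>2 - (u a - v a)\<^sup>2"
    using ac_with_deriv_integration_by_parts[OF less_imp_le[OF ab] d d]
    by (simp add: power2_eq_square mult.commute flip: mult_2)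
  ultimately show ?thesis by simp
qed

definition decaying_boundary :: "real \<Rightarrow> real \<Rightarrow> (real \<Rightarrow> real) set \<Rightarrow> real" where
  "decaying_boundary a b U = decaying_coeff a b (cont_rep a b U a) (cont_rep a b U b)"

definition growing_boundary :: "real \<Rightarrow> real \<Rightarrow> (real \<Rightarrow> real) set \<Rightarrow> real" where
  "growing_boundary a b U = growing_coeff a b (cont_rep a b U a) (cont_rep a b U b)"

lemma boundary_l2_class:
  assumes "a < b" "ac_with_deriv a b u v"
  shows "decaying_boundary a b (l2_class a b u) = decaying_coeff a b (u a) (u b)"
    and "growing_boundary a b (l2_class a b u) = growing_coeff a b (u a) (u b)"
  using assms(1) cont_rep_l2_class[OF assms(1) ac_with_deriv_continuous_on[OF assms(2)]]
  by (simp_all add: decaying_boundary_def growing_boundary_def)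

text \<open>The inner product is a boundary form, which the two coordinates diagonalise. They are linear, so the
  differences of the coordinates are the coordinates of the difference.\<close>

lemma weak_deriv_op_pair_monotone_iff:
  assumes ab: "a < b" and U: "(U, X) \<in> weak_deriv_op a b" and V: "(V, Y) \<in> weak_deriv_op a b"
  shows "0 \<le> l2_inner a b (l2_diff a b X Y) (l2_diff a b U V) \<longleftrightarrow>
    \<bar>decaying_boundary a b U - decaying_boundary a b V\<bar>
      \<le> exp (a + b) * \<bar>growing_boundary a b U - growing_boundary a b V\<bar>"
proof -
  obtain u x where u: "ac_with_deriv a b u x" "x \<in> square_integrable a b"
    "U = l2_class a b u" "X = l2_class a b x"
    using U weak_deriv_op_iff[OF ab] by blast
  obtain v y where v: "ac_with_deriv a b v y" "y \<in> square_integrable a b"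
    "V = l2_class a b v" "Y = l2_class a b y"
    using V weak_deriv_op_iff[OF ab] by blast
  show ?thesis
    unfolding u(3,4) v(3,4) l2_inner_deriv_diff[OF ab u(1,2) v(1,2)]
      boundary_l2_class[OF ab u(1)] boundary_l2_class[OF ab v(1)]
      growing_coeff_diff decaying_coeff_diff abs_boundary_le_iff[OF ab, symmetric] by simp
qed

text \<open>Integrating \<open>(exp * u)' = exp * f\<close> over the whole interval: the right-hand side \<open>f\<close> alone determines the growing
  coordinate of the solution.\<close>

lemma resolvent_determines_growing_boundary:
  assumes ab: "a < b" and U: "(U, X) \<in> weak_deriv_op a b"
    and f: "f \<in> square_integrable a b" "l2_add a b U X = l2_class a b f"
  shows "growing_boundary a b U
    = (\<integral>t. exp t * f t \<partial>lebesgue_on {a..b}) / (exp (2 * b) - exp (2 * a))"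
proof -
  obtain u x where u: "ac_with_deriv a b u x" "x \<in> square_integrable a b"
    "U = l2_class a b u" "X = l2_class a b x"
    using U weak_deriv_op_iff[OF ab] by blast
  have us: "u \<in> square_integrable a b"
    using u(1) by (intro continuous_on_square_integrable ac_with_deriv_continuous_on)
  have "AE t in lebesgue_on {a..b}. u t + x t = f t"
    using f(2) by (simp add: u(3,4) l2_add_class us u(2) l2_class_eq_iff square_integrable_add f(1))
  from resolvent_equation_solution[OF u(1) this square_integrable_imp_integrable[OF f(1)], of b]
  show ?thesis
    using ab by (simp add: u(3) boundary_l2_class[OF ab u(1)] growing_coeff_def mult.commute)
qed

text \<open>Two solutions of the same equation have the same growing coordinate. If the decaying ones agree too,
  then so do the initial values, and the first-order equation determines the rest.\<close>

lemma resolvent_injective_if_decaying_boundary_eq: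
  assumes ab: "a < b" and U: "(U, X) \<in> weak_deriv_op a b" and V: "(V, Y) \<in> weak_deriv_op a b"
    and eq: "l2_add a b U X = l2_add a b V Y" and bd: "decaying_boundary a b U = decaying_boundary a b V"
  shows "U = V"
proof -
  obtain u x where u: "ac_with_deriv a b u x" "x \<in> square_integrable a b"
    "U = l2_class a b u" "X = l2_class a b x"
    using U weak_deriv_op_iff[OF ab] by blast
  obtain v y where v: "ac_with_deriv a b v y" "y \<in> square_integrable a b"
    "V = l2_class a b v" "Y = l2_class a b y"
    using V weak_deriv_op_iff[OF ab] by blast
  have us: "u \<in> square_integrable a b" and vs: "v \<in> square_integrable a b"
    using u(1) v(1) by (auto intro: continuous_on_square_integrable ac_with_deriv_continuous_on)
  define f where "f t = u t + x t" for t
  have f: "f \<in> square_integrable a b"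
    unfolding f_def[abs_def] by (rule square_integrable_add[OF us u(2)])
  have Uf: "l2_add a b U X = l2_class a b f"
    by (simp add: u(3,4) l2_add_class us u(2) f_def[abs_def])
  have fv: "AE t in lebesgue_on {a..b}. v t + y t = f t"
    using eq unfolding Uf by (simp add: v(3,4) l2_add_class vs v(2) l2_class_eq_iff square_integrable_add f eq_commute)
  have fi: "integrable (lebesgue_on {a..b}) f"
    by (rule square_integrable_imp_integrable[OF f])
  have "growing_boundary a b U = growing_boundary a b V"
    using resolvent_determines_growing_boundary[OF ab U f Uf]
      resolvent_determines_growing_boundary[OF ab V f] Uf eq by simp
  then have "u a = v a"
    using bd boundary_values_from_coeffs(1)[OF ab, of "u a" "u b"]
      boundary_values_from_coeffs(1)[OF ab, of "v a" "v b"]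
    unfolding u(3) v(3) boundary_l2_class[OF ab u(1)] boundary_l2_class[OF ab v(1)] by metis
  have "u t = v t" if "t \<in> {a..b}" for t
  proof -
    have "exp t * u t = exp t * v t"
      using resolvent_equation_solution[OF u(1) _ fi that] resolvent_equation_solution[OF v(1) fv fi that]
        \<open>u a = v a\<close> by (simp add: f_def)
    then show ?thesis by simp
  qed
  then show ?thesis
    unfolding u(3) v(3) by (intro l2_class_cong AE_I2) simp
qed

text \<open>The initial value is free, and it is chosen such that the decaying coordinate becomes the prescribed function
  of the growing one, which is already known from the right-hand side.\<close>

lemma exists_resolvent_solution_with_boundary:
  assumes ab: "a < b" and F: "F \<in> L2 a b"
  shows "\<exists>U X. (U, X) \<in> weak_deriv_op a b \<and> l2_add a b U X = F \<and>
    decaying_boundary a b U = g (growing_boundary a b U)"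
proof -
  obtain f where f: "f \<in> square_integrable a b" "F = l2_class a b f"
    using F by (auto simp: L2_def)
  define q where "q = (\<integral>t. exp t * f t \<partial>lebesgue_on {a..b}) / (exp (2 * b) - exp (2 * a))"
  obtain u where u: "ac_with_deriv a b u (\<lambda>x. f x - u x)" "u a = q * exp a + g q * exp (- a)"
    using exists_resolvent_equation_solution[OF square_integrable_imp_integrable[OF f(1)]] by blast
  have us: "u \<in> square_integrable a b"
    by (rule continuous_on_square_integrable[OF ac_with_deriv_continuous_on[OF u(1)]])
  have xs: "(\<lambda>x. f x - u x) \<in> square_integrable a b"
    by (rule square_integrable_diff[OF f(1) us])
  have op: "(l2_class a b u, l2_class a b (\<lambda>x. f x - u x)) \<in> weak_deriv_op a b"
    using weak_deriv_op_iff[OF ab] u(1) xs by blast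
  have sum: "l2_add a b (l2_class a b u) (l2_class a b (\<lambda>x. f x - u x)) = F"
    by (simp add: l2_add_class us xs f(2))
  have gq: "growing_boundary a b (l2_class a b u) = q"
    using resolvent_determines_growing_boundary[OF ab op f(1)] sum f(2) by (simp add: q_def)
  have "decaying_boundary a b (l2_class a b u) = g q"
  proof -
    have "u a = q * exp a + decaying_coeff a b (u a) (u b) * exp (- a)"
      using gq boundary_values_from_coeffs(1)[OF ab, of "u a" "u b"]
      unfolding boundary_l2_class[OF ab u(1)] by metis
    with u(2) show ?thesis
      by (simp add: boundary_l2_class[OF ab u(1)])
  qed
  with op sum gq show ?thesis by blast
qed

lemma weak_deriv_op_single_valued:
  assumes ab: "a < b" and U: "(U, X) \<in> weak_deriv_op a b" and V: "(U, Y) \<in> weak_deriv_op a b"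
  shows "X = Y"
proof -
  obtain u x where u: "ac_with_deriv a b u x" "x \<in> square_integrable a b"
    "U = l2_class a b u" "X = l2_class a b x"
    using U weak_deriv_op_iff[OF ab] by blast
  obtain v y where v: "ac_with_deriv a b v y" "y \<in> square_integrable a b"
    "U = l2_class a b v" "Y = l2_class a b y"
    using V weak_deriv_op_iff[OF ab] by blast
  have uv: "u t = v t" if "t \<in> {a..b}" for t
    using cont_rep_l2_class[OF ab ac_with_deriv_continuous_on[OF u(1)] that]
      cont_rep_l2_class[OF ab ac_with_deriv_continuous_on[OF v(1)] that] u(3) v(3) by simp
  have "ac_with_deriv a b u y"
    unfolding ac_with_deriv_def
  proof (intro conjI ballI)
    show "u t = u a + integral\<^sup>L (lebesgue_on {a..t}) y" if "t \<in> {a..b}" for t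
      using ac_with_derivD(2)[OF v(1) that] uv[OF that] uv[of a] ab by simp
  qed (rule ac_with_derivD(1)[OF v(1)])
  then show ?thesis
    unfolding u(4) v(4) by (intro l2_class_cong ac_with_deriv_unique[OF u(1)])
qed

section \<open>Maximal accretive restrictions of the derivative\<close>

text \<open>Surjectivity makes every real number the growing coordinate of some element of the domain, and accretivity
  makes the decaying coordinate a Lipschitz function \<open>g\<close> of it. For the converse inclusion, take \<open>U\<close> on the graph of \<open>g\<close>
  and let \<open>V\<close> in the domain solve \<open>V + V' = U + U'\<close>; both coordinates of \<open>U\<close> and \<open>V\<close> agree, so \<open>U = V\<close>.\<close>

lemma m_accretive_imp_boundary_function:
  assumes ab: "a < b" and sub: "B \<subseteq> weak_deriv_op a b" and B: "m_accretive a b B"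
  shows "\<exists>g. (\<forall>c d. \<bar>g c - g d\<bar> \<le> exp (a + b) * \<bar>c - d\<bar>) \<and>
    Domain B = {U \<in> H1 a b. decaying_boundary a b U = g (growing_boundary a b U)}"
proof -
  have acc: "\<bar>decaying_boundary a b U - decaying_boundary a b V\<bar>
      \<le> exp (a + b) * \<bar>growing_boundary a b U - growing_boundary a b V\<bar>"
    if "(U, X) \<in> B" "(V, Y) \<in> B" for U X V Y
  proof -
    have "0 \<le> l2_inner a b (l2_diff a b X Y) (l2_diff a b U V)"
      using B that unfolding m_accretive_def accretive_def by blast
    then show ?thesis
      using that sub weak_deriv_op_pair_monotone_iff[OF ab, of U X V Y] by blast
  qed
  have onto: "\<exists>U X. (U, X) \<in> B \<and> l2_add a b U X = F" if "F \<in> L2 a b" for F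
    using B that unfolding m_accretive_def split_beta by (metis prod.collapse)
  \<comment> \<open>The right-hand side \<open>2 * c * exp\<close> is \<open>u + u'\<close> for \<open>u = c * exp\<close>, whose growing coordinate is \<open>c\<close>.\<close>
  have "\<exists>U\<in>Domain B. growing_boundary a b U = c" for c
  proof -
    have f: "(\<lambda>x. 2 * c * exp x) \<in> square_integrable a b"
      by (intro continuous_on_square_integrable continuous_intros)
    then obtain U X where U: "(U, X) \<in> B" "l2_add a b U X = l2_class a b (\<lambda>x. 2 * c * exp x)"
      using onto[of "l2_class a b (\<lambda>x. 2 * c * exp x)"] by (auto simp: L2_def)
    have d: "((\<lambda>x. c * exp (2 * x)) has_real_derivative exp x * (2 * c * exp x)) (at x)" for x
      by (auto intro!: derivative_eq_intros simp: exp_double power2_eq_square)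
    have "ac_with_deriv a b (\<lambda>x. c * exp (2 * x)) (\<lambda>x. exp x * (2 * c * exp x))"
      by (intro ac_with_deriv_C1 d continuous_intros)
    from ac_with_derivD(2)[OF this, of b]
    have "(\<integral>t. exp t * (2 * c * exp t) \<partial>lebesgue_on {a..b}) = c * (exp (2 * b) - exp (2 * a))"
      using ab by (simp add: right_diff_distrib)
    moreover have "exp (2 * b) - exp (2 * a) \<noteq> 0"
      using ab by simp
    ultimately have "growing_boundary a b U = c"
      using resolvent_determines_growing_boundary[OF ab _ f U(2)] U(1) sub by auto
    with U(1) show ?thesis by blast
  qed
  then obtain W where W: "W c \<in> Domain B" "growing_boundary a b (W c) = c" for c
    by metis
  define g where "g c = decaying_boundary a b (W c)" for c
  have "\<bar>g c - g d\<bar> \<le> exp (a + b) * \<bar>c - d\<bar>" for c d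
    using W[of c] W[of d] acc unfolding g_def by (metis DomainE)
  moreover have on_graph: "decaying_boundary a b U = g (growing_boundary a b U)" if "(U, X) \<in> B" for U X
  proof -
    obtain Y where "(W (growing_boundary a b U), Y) \<in> B"
      using W(1) by blast
    from acc[OF that this] show ?thesis
      by (simp add: W(2) g_def)
  qed
  moreover have "U \<in> Domain B" if U: "U \<in> H1 a b" "decaying_boundary a b U = g (growing_boundary a b U)" for U
  proof -
    obtain X where X: "(U, X) \<in> weak_deriv_op a b"
      using U(1) unfolding H1_eq_Domain by blast
    then obtain u x where u: "u \<in> square_integrable a b" "x \<in> square_integrable a b"
      "U = l2_class a b u" "X = l2_class a b x"
      by (auto simp: weak_deriv_op_def H1_def L2_def)
    have s: "(\<lambda>t. u t + x t) \<in> square_integrable a b"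
      by (rule square_integrable_add[OF u(1,2)])
    have UX: "l2_add a b U X = l2_class a b (\<lambda>t. u t + x t)"
      by (simp add: u l2_add_class)
    then obtain V Y where V: "(V, Y) \<in> B" "l2_add a b V Y = l2_add a b U X"
      using onto[of "l2_add a b U X"] s by (auto simp: L2_def)
    then have V': "(V, Y) \<in> weak_deriv_op a b"
      using sub by blast
    have "growing_boundary a b V = growing_boundary a b U"
      using resolvent_determines_growing_boundary[OF ab X s UX]
        resolvent_determines_growing_boundary[OF ab V' s] UX V(2) by simp
    then have "decaying_boundary a b V = decaying_boundary a b U"
      using on_graph[OF V(1)] U(2) by simp
    then have "V = U"
      by (rule resolvent_injective_if_decaying_boundary_eq[OF ab V' X V(2)])
    with V(1) show ?thesis by blast
  qed
  ultimately show ?thesis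
    using sub unfolding H1_eq_Domain by (intro exI[of _ g] conjI) blast+
qed

text \<open>The solution with boundary coordinates on the graph of \<open>g\<close> lies in the domain of \<open>B\<close>; that \<open>B\<close> maps it to
  its derivative holds because the weak derivative is single-valued.\<close>

lemma boundary_function_imp_m_accretive:
  assumes ab: "a < b" and sub: "B \<subseteq> weak_deriv_op a b"
    and lip: "\<And>c d. \<bar>g c - g d\<bar> \<le> exp (a + b) * \<bar>c - d\<bar>"
    and dom: "Domain B = {U \<in> H1 a b. decaying_boundary a b U = g (growing_boundary a b U)}"
  shows "m_accretive a b B"
  unfolding m_accretive_def
proof (intro conjI ballI)
  have "0 \<le> l2_inner a b (l2_diff a b X Y) (l2_diff a b U V)" if "(U, X) \<in> B" "(V, Y) \<in> B" for U X V Y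
  proof -
    have "decaying_boundary a b U = g (growing_boundary a b U)"
      "decaying_boundary a b V = g (growing_boundary a b V)"
      using that dom by auto
    then show ?thesis
      using that sub lip by (subst weak_deriv_op_pair_monotone_iff[OF ab]) auto
  qed
  then show "accretive a b B"
    by (auto simp: accretive_def)
  fix F assume "F \<in> L2 a b"
  then obtain U X where U: "(U, X) \<in> weak_deriv_op a b" "l2_add a b U X = F"
    "decaying_boundary a b U = g (growing_boundary a b U)"
    using exists_resolvent_solution_with_boundary[OF ab] by metis
  then have "U \<in> Domain B"
    by (auto simp: dom H1_eq_Domain)
  then obtain Y where Y: "(U, Y) \<in> B"
    by blast
  then have "Y = X"
    using sub weak_deriv_op_single_valued[OF ab _ U(1)] by blast
  with Y U(2) show "\<exists>(U, X)\<in>B. l2_add a b U X = F"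
    by blast
qed

theorem theorem4p3:
  fixes a b :: real and B :: l2_operator
  assumes "a < b"
    and "B \<subseteq> weak_deriv_op a b"
  shows "m_accretive a b B \<longleftrightarrow>
    (\<exists>g :: real \<Rightarrow> real.
       (\<forall>c d. \<bar>g c - g d\<bar> \<le> exp (a + b) * \<bar>c - d\<bar>) \<and>
       Domain B =
         {U \<in> H1 a b.
            (cont_rep a b U a * exp (- a) - cont_rep a b U b * exp (- b))
                / (exp (- 2 * a) - exp (- 2 * b))
              = g ((cont_rep a b U b * exp b - cont_rep a b U a * exp a)
                    / (exp (2 * b) - exp (2 * a)))})"
  using m_accretive_imp_boundary_function[OF assms] boundary_function_imp_m_accretive[OF assms]
  unfolding decaying_boundary_def growing_boundary_def decaying_coeff_def growing_coeff_def
  by blast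

end
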